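(* Let $A$ be an $H^*$-Galois left $H$-module algebra over a finite dimensional Hopf algebra $H$. Suppose that $H$ is cocommutative and $A$ is central simple. Let $n$ be the order of the modular function $\alpha$ of $H$ in the group of invertible elements of $H^*$. Then the antipode $S$ of the Hopf algebra $E=\operatorname{End}_HA$ satisfies $S^{2n}=\operatorname{id}$. If $1$ is the only central grouplike element in $H$, then the order of $S^2$ equals $n$ exactly.
   Context: $k$ is a field; unadorned $\otimes$, $\operatorname{Hom}$, $\operatorname{End}$ are over $k$. $H$ is a finite dimensional Hopf algebra over $k$ with $\Delta h=\sum_{(h)}h'\otimes h''$, counit $\varepsilon$. Algebras are extensions of $k$ (so $A\neq0$, $k=k1_A\subset A$). A left $H$-module algebra $A$ is $H^*$-Galois if the map $\pi:A\otimes H\to\operatorname{End}A$, $\pi(a\otimes h)(b)=a(hb)$, is bijective; equivalently (known fact) if any one of the maps $\pi'(a\otimes h)(b)=(hb)a$ from $A\otimes H$ to $\operatorname{End}A$, $\gamma(a\otimes b)(h)=a(hb)$, $\gamma'(a\otimes b)(h)=(ha)b$ from $A\otimes A$ to $\operatorname{Hom}(H,A)\cong A\otimes H^*$ is bijective. Then $\dim A<\infty$ and $A^H=k$. $E=\operatorname{End}_HA$ acts on $A$ from the left and carries the unique Hopf algebra structure making $A$ a left $E$-module algebra: $\varphi(ab)=\sum_{(\varphi)}\varphi'(a)\varphi''(b)$, $\varepsilon(\varphi)=\varphi(1)$. A left integral is a nonzero $x\in H$ with $hx=\varepsilon(h)x$ for all $h\in H$ (unique up to scalar); the modular function of $H$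 is the algebra homomorphism $\alpha:H\to k$ with $xh=\alpha(h)x$ for all $h\in H$. It is a grouplike, hence invertible, element of $H^*$. *)

theory Defs
  imports
    "HOL-Library.Function_Algebras"
    "HOL-Algebra.Multiplicative_Group"
    "HOL-Algebra.Bij"
begin

text \<open>
  Vector spaces over the field \<^typ>\<open>'k\<close> are subspaces \<open>V\<close> of a type with a scaling
  operation \<open>s\<close> satisfying the library locale \<^locale>\<open>vector_space\<close>.  Carriers are kept
  explicit because \<open>End\<^sub>H A\<close> is a subspace of the function type \<^typ>\<open>'a \<Rightarrow> 'a\<close>.
\<close>

definition fun_scale :: "('k \<Rightarrow> 'u \<Rightarrow> 'u) \<Rightarrow> 'k \<Rightarrow> ('x \<Rightarrow> 'u) \<Rightarrow> ('x \<Rightarrow> 'u)" where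
  "fun_scale s c f = (\<lambda>x. s c (f x))"

definition linear_on ::
    "('k \<Rightarrow> 'v::ab_group_add \<Rightarrow> 'v) \<Rightarrow> 'v set \<Rightarrow> ('k \<Rightarrow> 'u::ab_group_add \<Rightarrow> 'u)
      \<Rightarrow> ('v \<Rightarrow> 'u) \<Rightarrow> bool" where
  "linear_on sV V sU f \<longleftrightarrow>
    (\<forall>x\<in>V. \<forall>y\<in>V. f (x + y) = f x + f y) \<and> (\<forall>c. \<forall>x\<in>V. f (sV c x) = sU c (f x))"

definition bilinear_on ::
    "('k \<Rightarrow> 'v::ab_group_add \<Rightarrow> 'v) \<Rightarrow> 'v set \<Rightarrow> ('k \<Rightarrow> 'w::ab_group_add \<Rightarrow> 'w) \<Rightarrow> 'w set
      \<Rightarrow> ('k \<Rightarrow> 'u::ab_group_add \<Rightarrow> 'u) \<Rightarrow> ('v \<Rightarrow> 'w \<Rightarrow> 'u) \<Rightarrow> bool" where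
  "bilinear_on sV V sW W sU f \<longleftrightarrow>
    (\<forall>w\<in>W. linear_on sV V sU (\<lambda>v. f v w)) \<and> (\<forall>v\<in>V. linear_on sW W sU (f v))"

lemma vector_space_fun_scale:
  assumes "vector_space s"
  shows "vector_space (fun_scale s)"
proof -
  interpret vector_space s by fact
  show ?thesis
    by unfold_locales
      (auto simp: fun_scale_def fun_eq_iff scale_right_distrib scale_left_distrib)
qed

lemma vector_space_times: "vector_space ((*) :: 'k::field \<Rightarrow> 'k \<Rightarrow> 'k)"
  by unfold_locales (auto simp: algebra_simps)


section \<open>Tensor products\<close>

text \<open>
  Over a field, the tensor product of \<open>V\<close> and \<open>W\<close> embeds into the dual of the space of
  bilinear forms on \<open>V \<times> W\<close>, the pure tensor of \<open>v\<close> and \<open>w\<close> being evaluation at \<open>(v, w)\<close>.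
  This model is used below; its scaling is \<^term>\<open>fun_scale (*)\<close>.  The lemmas of this section
  establish the universal property.
\<close>

definition tensor ::
    "('k::field \<Rightarrow> 'v::ab_group_add \<Rightarrow> 'v) \<Rightarrow> 'v set \<Rightarrow> ('k \<Rightarrow> 'w::ab_group_add \<Rightarrow> 'w) \<Rightarrow> 'w set
      \<Rightarrow> 'v \<Rightarrow> 'w \<Rightarrow> (('v \<Rightarrow> 'w \<Rightarrow> 'k) \<Rightarrow> 'k)" where
  "tensor sV V sW W v w = (\<lambda>B. if bilinear_on sV V sW W (*) B then B v w else 0)"

definition tensor_space ::
    "('k::field \<Rightarrow> 'v::ab_group_add \<Rightarrow> 'v) \<Rightarrow> 'v set \<Rightarrow> ('k \<Rightarrow> 'w::ab_group_add \<Rightarrow> 'w) \<Rightarrow> 'w set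
      \<Rightarrow> (('v \<Rightarrow> 'w \<Rightarrow> 'k) \<Rightarrow> 'k) set" where
  "tensor_space sV V sW W =
    {\<Sum>(v, w)\<leftarrow>xs. tensor sV V sW W v w | xs. set xs \<subseteq> V \<times> W}"

text \<open>
  The linear map on the tensor product induced by a map \<open>f\<close> that is bilinear on \<open>V \<times> W\<close>.
  In Sweedler notation, \<open>tensor_lift \<dots> f (\<Delta> h)\<close> is the sum of the \<open>f h' h''\<close>.
\<close>

definition tensor_lift ::
    "('k::field \<Rightarrow> 'v::ab_group_add \<Rightarrow> 'v) \<Rightarrow> 'v set \<Rightarrow> ('k \<Rightarrow> 'w::ab_group_add \<Rightarrow> 'w) \<Rightarrow> 'w set
      \<Rightarrow> ('v \<Rightarrow> 'w \<Rightarrow> 'u::ab_group_add) \<Rightarrow> (('v \<Rightarrow> 'w \<Rightarrow> 'k) \<Rightarrow> 'k) \<Rightarrow> 'u" where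
  "tensor_lift sV V sW W f t =
    (THE u. \<exists>xs. set xs \<subseteq> V \<times> W \<and> t = (\<Sum>(v, w)\<leftarrow>xs. tensor sV V sW W v w)
              \<and> u = (\<Sum>(v, w)\<leftarrow>xs. f v w))"

lemma sum_list_tensor_apply:
  "(\<Sum>(v, w)\<leftarrow>xs. tensor sV V sW W v w) B
    = (if bilinear_on sV V sW W (*) B then \<Sum>(v, w)\<leftarrow>xs. B v w else 0)"
  by (induction xs) (auto simp: tensor_def)

lemma functionals_separate:
  assumes "vector_space (sU :: 'k::field \<Rightarrow> 'u::ab_group_add \<Rightarrow> 'u)"
    and eq: "\<And>l. Vector_Spaces.linear sU (*) l \<Longrightarrow> l x = l y"
  shows "x = y"
proof (rule ccontr)
  assume "x \<noteq> y"
  interpret vector_space sU by fact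
  have ind: "independent {x - y}"
    using \<open>x \<noteq> y\<close> by (simp add: dependent_single)
  define C where "C = extend_basis {x - y}"
  have C: "independent C" "span C = UNIV" "x - y \<in> C"
    using independent_extend_basis[OF ind] span_extend_basis[OF ind] extend_basis_superset[OF ind]
    by (auto simp: C_def)
  have "Vector_Spaces.linear sU (*) (\<lambda>v. representation C v (x - y))"
    by (rule linear_representation[OF C(1,2)])
  then have "representation C x (x - y) = representation C y (x - y)"
    by (rule eq)
  moreover have "representation C (x - y) (x - y) = 1"
    using representation_basis[OF C(1,3)] by simp
  moreover have "representation C (x - y) (x - y)
      = representation C x (x - y) - representation C y (x - y)"
    using representation_diff[OF C(1), of y x] representation_diff[OF C(1), of x y] C(2)
    by simp
  ultimately show False by simp
qed

lemma tensor_lift_sum_list: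
  assumes "vector_space sU" and f: "bilinear_on sV V sW W sU f" and xs: "set xs \<subseteq> V \<times> W"
  shows "tensor_lift sV V sW W f (\<Sum>(v, w)\<leftarrow>xs. tensor sV V sW W v w) = (\<Sum>(v, w)\<leftarrow>xs. f v w)"
  unfolding tensor_lift_def
proof (rule the_equality)
  fix u
  assume "\<exists>ys. set ys \<subseteq> V \<times> W \<and>
    (\<Sum>(v, w)\<leftarrow>xs. tensor sV V sW W v w) = (\<Sum>(v, w)\<leftarrow>ys. tensor sV V sW W v w) \<and>
    u = (\<Sum>(v, w)\<leftarrow>ys. f v w)"
  then obtain ys where
    ys: "(\<Sum>(v, w)\<leftarrow>xs. tensor sV V sW W v w) = (\<Sum>(v, w)\<leftarrow>ys. tensor sV V sW W v w)"
    and u: "u = (\<Sum>(v, w)\<leftarrow>ys. f v w)" by blast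
  show "u = (\<Sum>(v, w)\<leftarrow>xs. f v w)"
  proof (rule functionals_separate[OF assms(1)])
    fix l assume l: "Vector_Spaces.linear sU (*) l"
    interpret l: Vector_Spaces.linear sU "(*)" l by fact
    have B: "bilinear_on sV V sW W (*) (\<lambda>v w. l (f v w))"
      using f by (auto simp: bilinear_on_def linear_on_def l.add l.scale)
    have ls: "l (\<Sum>(v, w)\<leftarrow>zs. f v w) = (\<Sum>(v, w)\<leftarrow>zs. l (f v w))" for zs
      by (induction zs) (auto simp: l.add l.zero)
    show "l u = l (\<Sum>(v, w)\<leftarrow>xs. f v w)"
      using fun_cong[OF ys, of "\<lambda>v w. l (f v w)"]
      by (simp only: sum_list_tensor_apply B if_True u ls)
  qed
qed (use xs in blast)

lemma tensor_in_tensor_space: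
  assumes "v \<in> V" "w \<in> W"
  shows "tensor sV V sW W v w \<in> tensor_space sV V sW W"
  unfolding tensor_space_def using assms by (intro CollectI exI[of _ "[(v, w)]"]) auto

lemma bilinear_tensor:
  "bilinear_on sV V sW W (fun_scale (*)) (tensor sV V sW W)"
  unfolding bilinear_on_def linear_on_def tensor_def fun_scale_def fun_eq_iff by auto

lemma tensor_lift_tensor:
  assumes "vector_space sU" "bilinear_on sV V sW W sU f" "v \<in> V" "w \<in> W"
  shows "tensor_lift sV V sW W f (tensor sV V sW W v w) = f v w"
  using tensor_lift_sum_list[OF assms(1,2), of "[(v, w)]"] assms(3,4) by simp

lemma subspace_tensor_space:
  fixes sV :: "'k::field \<Rightarrow> 'v::ab_group_add \<Rightarrow> 'v" and sW :: "'k \<Rightarrow> 'w::ab_group_add \<Rightarrow> 'w"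
  assumes "vector_space sV" "Modules.module.subspace sV V"
  shows "Modules.module.subspace (fun_scale (*)) (tensor_space sV V sW W)"
proof -
  interpret v: vector_space sV by fact
  interpret t: vector_space
    "fun_scale (*) :: 'k \<Rightarrow> (('v \<Rightarrow> 'w \<Rightarrow> 'k) \<Rightarrow> 'k) \<Rightarrow> (('v \<Rightarrow> 'w \<Rightarrow> 'k) \<Rightarrow> 'k)"
    by (rule vector_space_fun_scale[OF vector_space_times])
  let ?T = "\<lambda>xs. \<Sum>(v, w)\<leftarrow>xs. tensor sV V sW W v w"
  show ?thesis
  proof (rule t.subspaceI)
    show "0 \<in> tensor_space sV V sW W"
      unfolding tensor_space_def by (intro CollectI exI[of _ "[]"]) auto
  next
    fix x y assume "x \<in> tensor_space sV V sW W" "y \<in> tensor_space sV V sW W"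
    then obtain xs ys where "x = ?T xs" "y = ?T ys" "set xs \<subseteq> V \<times> W" "set ys \<subseteq> V \<times> W"
      unfolding tensor_space_def by blast
    then show "x + y \<in> tensor_space sV V sW W"
      unfolding tensor_space_def by (intro CollectI exI[of _ "xs @ ys"]) auto
  next
    fix c x assume "x \<in> tensor_space sV V sW W"
    then obtain xs where x: "x = ?T xs" and xs: "set xs \<subseteq> V \<times> W"
      unfolding tensor_space_def by blast
    have "fun_scale (*) c (?T xs) = ?T (map (\<lambda>(v, w). (sV c v, w)) xs)"
      using xs
    proof (induction xs)
      case (Cons p xs)
      obtain v w where p: "p = (v, w)" by force
      have "fun_scale (*) c (tensor sV V sW W v w) = tensor sV V sW W (sV c v) w"
        using bilinear_tensor[of sV V sW W] Cons.prems
        by (auto simp: p bilinear_on_def linear_on_def)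
      moreover have "fun_scale (*) c (?T xs) = ?T (map (\<lambda>(v, w). (sV c v, w)) xs)"
        using Cons by simp
      ultimately show ?case
        by (simp only: p t.scale_right_distrib list.map sum_list.Cons prod.case)
    qed (simp only: t.scale_zero_right list.map sum_list.Nil)
    moreover have "set (map (\<lambda>(v, w). (sV c v, w)) xs) \<subseteq> V \<times> W"
      using xs v.subspace_scale[OF assms(2)] by auto
    ultimately show "fun_scale (*) c x \<in> tensor_space sV V sW W"
      unfolding x tensor_space_def by blast
  qed
qed

theorem tensor_universal_property:
  assumes "vector_space sV" "Modules.module.subspace sV V" "vector_space sU"
    and f: "bilinear_on sV V sW W sU f"
  shows "linear_on (fun_scale (*)) (tensor_space sV V sW W) sU (tensor_lift sV V sW W f)"
    and "\<And>v w. v \<in> V \<Longrightarrow> w \<in> W \<Longrightarrow> tensor_lift sV V sW W f (tensor sV V sW W v w) = f v w"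
    and "\<And>g t. \<lbrakk>linear_on (fun_scale (*)) (tensor_space sV V sW W) sU g;
           \<And>v w. v \<in> V \<Longrightarrow> w \<in> W \<Longrightarrow> g (tensor sV V sW W v w) = f v w;
           t \<in> tensor_space sV V sW W\<rbrakk> \<Longrightarrow> g t = tensor_lift sV V sW W f t"
proof -
  interpret u: vector_space sU by fact
  interpret v: vector_space sV by fact
  interpret t: vector_space
    "fun_scale (*) :: 'a \<Rightarrow> (('b \<Rightarrow> 'd \<Rightarrow> 'a) \<Rightarrow> 'a) \<Rightarrow> (('b \<Rightarrow> 'd \<Rightarrow> 'a) \<Rightarrow> 'a)"
    by (rule vector_space_fun_scale[OF vector_space_times])
  let ?T = "\<lambda>xs. \<Sum>(v, w)\<leftarrow>xs. tensor sV V sW W v w"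
  let ?L = "tensor_lift sV V sW W f"
  note sub = subspace_tensor_space[OF assms(1,2), of sW W]
  note L = tensor_lift_sum_list[OF assms(3) f]
  show pure: "?L (tensor sV V sW W v w) = f v w" if "v \<in> V" "w \<in> W" for v w
    by (rule tensor_lift_tensor[OF assms(3) f that])
  have add: "?L (x + y) = ?L x + ?L y"
    if xy: "x \<in> tensor_space sV V sW W" "y \<in> tensor_space sV V sW W" for x y
  proof -
    obtain xs ys where *: "x = ?T xs" "y = ?T ys" "set xs \<subseteq> V \<times> W" "set ys \<subseteq> V \<times> W"
      using xy unfolding tensor_space_def by blast
    have "x + y = ?T (xs @ ys)" using * by simp
    moreover have "?L (?T (xs @ ys)) = ?L x + ?L y"
      using * by (subst L) (auto simp: L)
    ultimately show ?thesis by simp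
  qed
  have scl: "?L (fun_scale (*) c x) = sU c (?L x)" if x: "x \<in> tensor_space sV V sW W" for c x
  proof -
    obtain xs where x: "x = ?T xs" and xs: "set xs \<subseteq> V \<times> W"
      using x unfolding tensor_space_def by blast
    show ?thesis unfolding x using xs
    proof (induction xs)
      case Nil
      have "?L 0 = 0" using L[of "[]"] by simp
      then show ?case
        by (simp only: t.scale_zero_right u.scale_zero_right list.map sum_list.Nil)
    next
      case (Cons p xs)
      obtain v w where p: "p = (v, w)" by force
      then have vw: "v \<in> V" "w \<in> W" using Cons.prems by auto
      have *: "fun_scale (*) c (tensor sV V sW W v w) = tensor sV V sW W (sV c v) w"
        using bilinear_tensor[of sV V sW W] vw by (auto simp: bilinear_on_def linear_on_def)
      have cv: "sV c v \<in> V" using v.subspace_scale[OF assms(2)] vw by blast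
      have T: "?T xs \<in> tensor_space sV V sW W"
        using Cons.prems unfolding tensor_space_def by auto
      have "?L (fun_scale (*) c (?T (p # xs)))
          = ?L (tensor sV V sW W (sV c v) w + fun_scale (*) c (?T xs))"
        by (simp add: p * t.scale_right_distrib)
      also have "\<dots> = f (sV c v) w + sU c (?L (?T xs))"
        using Cons t.subspace_scale[OF sub T] cv vw
        by (simp add: add tensor_in_tensor_space pure)
      also have "f (sV c v) w = sU c (f v w)"
        using f vw by (auto simp: bilinear_on_def linear_on_def)
      also have "sU c (f v w) + sU c (?L (?T xs)) = sU c (?L (?T (p # xs)))"
        using vw T by (simp add: p add tensor_in_tensor_space pure u.scale_right_distrib)
      finally show ?case .
    qed
  qed
  show "linear_on (fun_scale (*)) (tensor_space sV V sW W) sU ?L"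
    unfolding linear_on_def using add scl by blast
  fix g t
  assume g: "linear_on (fun_scale (*)) (tensor_space sV V sW W) sU g"
    and gp: "\<And>v w. v \<in> V \<Longrightarrow> w \<in> W \<Longrightarrow> g (tensor sV V sW W v w) = f v w"
    and t: "t \<in> tensor_space sV V sW W"
  obtain xs where x: "t = ?T xs" and xs: "set xs \<subseteq> V \<times> W"
    using t unfolding tensor_space_def by blast
  show "g t = ?L t" unfolding x using xs
  proof (induction xs)
    case Nil
    have "g (fun_scale (*) 0 0) = sU 0 (g 0)"
      using g t.subspace_0[OF sub] unfolding linear_on_def by blast
    then have "g 0 = 0" by simp
    moreover have "?L 0 = 0" using L[of "[]"] by simp
    ultimately show ?case by (simp only: list.map sum_list.Nil)
  next
    case (Cons p xs)
    obtain v w where p: "p = (v, w)" by force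
    then have vw: "tensor sV V sW W v w \<in> tensor_space sV V sW W"
      "g (tensor sV V sW W v w) = ?L (tensor sV V sW W v w)"
      using Cons.prems by (auto simp: tensor_in_tensor_space gp pure)
    have T: "?T xs \<in> tensor_space sV V sW W"
      using Cons.prems unfolding tensor_space_def by auto
    have "g (tensor sV V sW W v w + ?T xs) = g (tensor sV V sW W v w) + g (?T xs)"
      using g vw(1) T unfolding linear_on_def by blast
    also have "\<dots> = ?L (tensor sV V sW W v w + ?T xs)"
      using Cons by (simp only: add[OF vw(1) T] vw(2)) simp
    finally show ?case by (simp only: p list.map sum_list.Cons prod.case)
  qed
qed


section \<open>Hopf algebras and module algebras\<close>

locale unital_algebra = vector_space scale
  for scale :: "'k::field \<Rightarrow> 'v::ab_group_add \<Rightarrow> 'v" +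
  fixes V :: "'v set" and mul :: "'v \<Rightarrow> 'v \<Rightarrow> 'v" and e :: 'v
  assumes subspace_V: "subspace V"
    and e_closed: "e \<in> V"
    and e_nonzero: "e \<noteq> 0"
    and mul_closed: "\<lbrakk>x \<in> V; y \<in> V\<rbrakk> \<Longrightarrow> mul x y \<in> V"
    and mul_assoc: "\<lbrakk>x \<in> V; y \<in> V; z \<in> V\<rbrakk> \<Longrightarrow> mul (mul x y) z = mul x (mul y z)"
    and mul_e_left: "x \<in> V \<Longrightarrow> mul e x = x"
    and mul_e_right: "x \<in> V \<Longrightarrow> mul x e = x"
    and mul_bilinear: "bilinear_on scale V scale V scale mul"

text \<open>
  In coassociativity both sides are compared in \<open>(V \<otimes> V) \<otimes> V\<close>: the right-hand side is the image
  of \<open>\<Sum> h' \<otimes> \<Delta> h''\<close> under the canonical isomorphism \<open>V \<otimes> (V \<otimes> V) \<cong> (V \<otimes> V) \<otimes> V\<close>.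
\<close>

locale hopf_algebra = unital_algebra scale V mul e
  for scale :: "'k::field \<Rightarrow> 'v::ab_group_add \<Rightarrow> 'v" and V :: "'v set"
    and mul :: "'v \<Rightarrow> 'v \<Rightarrow> 'v" and e :: 'v +
  fixes comul :: "'v \<Rightarrow> (('v \<Rightarrow> 'v \<Rightarrow> 'k) \<Rightarrow> 'k)"
    and counit :: "'v \<Rightarrow> 'k"
    and antipode :: "'v \<Rightarrow> 'v"
  assumes comul_closed: "h \<in> V \<Longrightarrow> comul h \<in> tensor_space scale V scale V"
    and comul_linear: "linear_on scale V (fun_scale (*)) comul"
    and counit_linear: "linear_on scale V (*) counit"
    and coassoc: "h \<in> V \<Longrightarrow>
      tensor_lift scale V scale V
        (\<lambda>x y. tensor (fun_scale (*)) (tensor_space scale V scale V) scale V (comul x) y) (comul h)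
      = tensor_lift scale V scale V
        (\<lambda>x y. tensor_lift scale V scale V
          (\<lambda>y' y''. tensor (fun_scale (*)) (tensor_space scale V scale V) scale V
            (tensor scale V scale V x y') y'') (comul y)) (comul h)"
    and counit_left: "h \<in> V \<Longrightarrow>
      tensor_lift scale V scale V (\<lambda>x y. scale (counit x) y) (comul h) = h"
    and counit_right: "h \<in> V \<Longrightarrow>
      tensor_lift scale V scale V (\<lambda>x y. scale (counit y) x) (comul h) = h"
    and comul_mul: "\<lbrakk>g \<in> V; h \<in> V\<rbrakk> \<Longrightarrow>
      comul (mul g h) =
        tensor_lift scale V scale V
          (\<lambda>x y. tensor_lift scale V scale V
            (\<lambda>x' y'. tensor scale V scale V (mul x x') (mul y y')) (comul h)) (comul g)"
    and comul_e: "comul e = tensor scale V scale V e e"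
    and counit_mul: "\<lbrakk>g \<in> V; h \<in> V\<rbrakk> \<Longrightarrow> counit (mul g h) = counit g * counit h"
    and counit_e: "counit e = 1"
    and antipode_closed: "h \<in> V \<Longrightarrow> antipode h \<in> V"
    and antipode_linear: "linear_on scale V scale antipode"
    and antipode_left: "h \<in> V \<Longrightarrow>
      tensor_lift scale V scale V (\<lambda>x y. mul (antipode x) y) (comul h) = scale (counit h) e"
    and antipode_right: "h \<in> V \<Longrightarrow>
      tensor_lift scale V scale V (\<lambda>x y. mul x (antipode y)) (comul h) = scale (counit h) e"

locale module_algebra =
  hopf_algebra scale V mul e comul counit antipode +
  alg: unital_algebra sA "UNIV :: 'a::ring_1 set" "(*)" 1
  for scale :: "'k::field \<Rightarrow> 'v::ab_group_add \<Rightarrow> 'v" and V mul e comul counit antipode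
    and sA :: "'k \<Rightarrow> 'a::ring_1 \<Rightarrow> 'a" +
  fixes act :: "'v \<Rightarrow> 'a \<Rightarrow> 'a"
  assumes act_bilinear: "bilinear_on scale V sA UNIV sA act"
    and act_mul: "\<lbrakk>g \<in> V; h \<in> V\<rbrakk> \<Longrightarrow> act (mul g h) a = act g (act h a)"
    and act_e: "act e a = a"
    and act_prod: "h \<in> V \<Longrightarrow>
      act h (a * b) = tensor_lift scale V scale V (\<lambda>x y. act x a * act y b) (comul h)"
    and act_one: "h \<in> V \<Longrightarrow> act h 1 = sA (counit h) 1"

definition finite_dim :: "('k::field \<Rightarrow> 'v::ab_group_add \<Rightarrow> 'v) \<Rightarrow> bool" where
  "finite_dim s \<longleftrightarrow> (\<exists>B. finite B \<and> Modules.module.span s B = UNIV)"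

text \<open>
  From here on the Hopf algebra \<open>H\<close> and the algebra \<open>A\<close> are whole types \<^typ>\<open>'h::ring_1\<close> and
  \<^typ>\<open>'a::ring_1\<close>.
\<close>

definition dual_galois ::
    "('k::field \<Rightarrow> 'h::ring_1 \<Rightarrow> 'h) \<Rightarrow> ('k \<Rightarrow> 'a::ring_1 \<Rightarrow> 'a) \<Rightarrow> ('h \<Rightarrow> 'a \<Rightarrow> 'a) \<Rightarrow> bool" where
  "dual_galois sH sA act \<longleftrightarrow>
    bij_betw (tensor_lift sA UNIV sH UNIV (\<lambda>a h b. a * act h b))
      (tensor_space sA UNIV sH UNIV) {f. Vector_Spaces.linear sA sA f}"

definition module_End ::
    "('k::field \<Rightarrow> 'a::ring_1 \<Rightarrow> 'a) \<Rightarrow> ('h \<Rightarrow> 'a \<Rightarrow> 'a) \<Rightarrow> ('a \<Rightarrow> 'a) set" where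
  "module_End sA act = {f. Vector_Spaces.linear sA sA f \<and> (\<forall>h a. f (act h a) = act h (f a))}"

definition cocommutative ::
    "('k::field \<Rightarrow> 'h::ring_1 \<Rightarrow> 'h) \<Rightarrow> ('h \<Rightarrow> (('h \<Rightarrow> 'h \<Rightarrow> 'k) \<Rightarrow> 'k)) \<Rightarrow> bool" where
  "cocommutative sH comul \<longleftrightarrow>
    (\<forall>h. tensor_lift sH UNIV sH UNIV (\<lambda>x y. tensor sH UNIV sH UNIV y x) (comul h) = comul h)"

definition two_sided_ideal :: "'a::ring_1 set \<Rightarrow> bool" where
  "two_sided_ideal I \<longleftrightarrow>
    0 \<in> I \<and> (\<forall>x\<in>I. \<forall>y\<in>I. x + y \<in> I) \<and> (\<forall>x\<in>I. \<forall>a. a * x \<in> I \<and> x * a \<in> I)"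

text \<open>
  As usual, central simple algebras are finite dimensional by definition.  (For a Galois
  module algebra this is automatic.)
\<close>

definition central_simple :: "('k::field \<Rightarrow> 'a::ring_1 \<Rightarrow> 'a) \<Rightarrow> bool" where
  "central_simple sA \<longleftrightarrow>
    finite_dim sA \<and>
    {z. \<forall>a. z * a = a * z} = range (\<lambda>c. sA c 1) \<and>
    (\<forall>I :: 'a set. two_sided_ideal I \<longrightarrow> I = {0} \<or> I = UNIV)"

definition left_integral ::
    "('k::field \<Rightarrow> 'h::ring_1 \<Rightarrow> 'h) \<Rightarrow> ('h \<Rightarrow> 'k) \<Rightarrow> 'h \<Rightarrow> bool" where
  "left_integral sH counit x \<longleftrightarrow> x \<noteq> 0 \<and> (\<forall>h. h * x = sH (counit h) x)"

definition modular_function ::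
    "('k::field \<Rightarrow> 'h::ring_1 \<Rightarrow> 'h) \<Rightarrow> ('h \<Rightarrow> 'k) \<Rightarrow> ('h \<Rightarrow> 'k) \<Rightarrow> bool" where
  "modular_function sH counit \<alpha> \<longleftrightarrow>
    Vector_Spaces.linear sH (*) \<alpha> \<and> (\<forall>g h. \<alpha> (g * h) = \<alpha> g * \<alpha> h) \<and> \<alpha> 1 = 1 \<and>
    (\<exists>x. left_integral sH counit x \<and> (\<forall>h. x * h = sH (\<alpha> h) x))"

text \<open>The dual of \<open>H\<close> under convolution, as a multiplicative monoid.\<close>

definition dual_algebra ::
    "('k::field \<Rightarrow> 'h::ring_1 \<Rightarrow> 'h) \<Rightarrow> ('h \<Rightarrow> (('h \<Rightarrow> 'h \<Rightarrow> 'k) \<Rightarrow> 'k)) \<Rightarrow> ('h \<Rightarrow> 'k)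
      \<Rightarrow> ('h \<Rightarrow> 'k) monoid" where
  "dual_algebra sH comul counit =
    \<lparr>carrier = {f. Vector_Spaces.linear sH (*) f},
     mult = (\<lambda>f g h. tensor_lift sH UNIV sH UNIV (\<lambda>x y. f x * g y) (comul h)),
     one = counit\<rparr>"

definition grouplike ::
    "('k::field \<Rightarrow> 'h::ring_1 \<Rightarrow> 'h) \<Rightarrow> ('h \<Rightarrow> (('h \<Rightarrow> 'h \<Rightarrow> 'k) \<Rightarrow> 'k)) \<Rightarrow> ('h \<Rightarrow> 'k)
      \<Rightarrow> 'h \<Rightarrow> bool" where
  "grouplike sH comul counit g \<longleftrightarrow> comul g = tensor sH UNIV sH UNIV g g \<and> counit g = 1"

end

theory Submission
  imports Defs
begin

text \<open>
  Let \<open>x\<close> be a left integral of \<open>H\<close>.  Since \<open>A\<close> is Galois, its invariants are scalars, so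
  \<open>x a = t a\<close> for a linear form \<open>t\<close>; it satisfies \<open>t (h a) = \<alpha> h * t a\<close>, and the bilinear form
  \<open>t (a * b)\<close> is nondegenerate.  Hence \<open>t (a * b) = t (b * \<nu> a)\<close> for an algebra automorphism \<open>\<nu>\<close> of
  \<open>A\<close>, which commutes with the action of \<open>H\<close> because \<open>H\<close> is cocommutative.  The form \<open>t\<close> is also
  invariant under \<open>E\<close>, since \<open>E\<close> commutes with \<open>x\<close>.  Therefore \<open>t (\<phi> a * b) = t (a * S \<phi> b)\<close> for
  \<open>\<phi>\<close> in \<open>E\<close>, and applying this twice gives \<open>S (S \<phi>) = \<nu> \<phi> \<nu>\<inverse>\<close> (\<open>antipode_square\<close>).  So the
  order of \<open>S\<^sup>2\<close> is the least \<open>m > 0\<close> for which \<open>\<nu>\<^sup>m\<close> commutes with \<open>E\<close>.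

  If \<open>\<nu>\<^sup>m\<close> commutes with \<open>E\<close>, then the double centraliser property of the Galois module \<open>A\<close>
  (\<open>double_centralizer\<close>) makes it the action of some \<open>g\<close> in \<open>H\<close>.  As \<open>\<nu>\<^sup>m\<close> is an algebra
  automorphism commuting with \<open>H\<close>, this \<open>g\<close> is grouplike and central; if \<open>1\<close> is the only such
  element, \<open>\<nu>\<^sup>m\<close> is the identity.

  It remains to see that \<open>\<nu>\<close> and \<open>\<alpha>\<close> have the same order (\<open>nu_pow_eq_id_iff\<close>).  By the
  Skolem-Noether theorem \<open>\<nu>\<close> is inner: \<open>\<nu> y = v\<inverse> y v\<close>.  This determines \<open>v\<close> up to a scalar, and
  \<open>h v\<close> has the same property as \<open>v\<close>, so \<open>h v = \<chi> h v\<close> for a functional \<open>\<chi>\<close>, and \<open>\<nu>\<^sup>m = id\<close> holds if and only if \<open>v\<^sup>m\<close> is a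
  scalar, if and only if \<open>\<chi>\<^sup>m = \<epsilon>\<close>.  The form \<open>tr a = t (v * a)\<close> is symmetric, so it is a multiple
  of the reduced trace.  If \<open>tr\<close> is invariant under \<open>H\<close>, then evaluating \<open>t (h (v * a))\<close> in two
  ways gives \<open>\<chi> = \<alpha>\<close>.

  The invariance of the trace under a cocommutative Hopf algebra (\<open>trace_invariant\<close>) is the most
  delicate point, because \<open>tr 1\<close> may vanish in positive characteristic.  Symmetric forms being
  unique up to scalars, \<open>tr (h a) = \<beta> h * tr a\<close> for a functional \<open>\<beta>\<close>.  In terms of the commutative
  convolution algebra of functionals on \<open>H\<close>, the action is an automorphism of the algebra
  obtained from \<open>A\<close> by extending scalars, and it is locally inner; elements implementing it and
  its inverse have central products, and comparing the two orders of multiplication shows that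
  \<open>\<beta> - \<epsilon>\<close> annihilates the squares of functionals whose sum is \<open>\<epsilon>\<close>.
\<close>


section \<open>Linear algebra with a fixed finite basis\<close>

lemma sum_fun_apply: "sum f I x = (\<Sum>i\<in>I. f i x)"
  by (induction I rule: infinite_finite_induct) auto

lemma (in vector_space) inj_linear_image_subspace:
  assumes f: "Vector_Spaces.linear scale scale f" and W: "subspace W"
    and fin: "finite F" "W \<subseteq> span F" and into: "f ` W \<subseteq> W" and inj: "inj_on f W"
  shows "f ` W = W"
proof
  show "f ` W \<subseteq> W" by (rule into)
  obtain B where B: "B \<subseteq> W" "independent B" "W \<subseteq> span B"
    using maximal_independent_subset by blast
  have spB: "span B = W"
    using B W span_minimal by blast
  have "finite B"
    using independent_span_bound[OF fin(1) B(2)] B(1) fin(2) by blast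
  have ind: "independent (f ` B)"
  proof -
    interpret p: vector_space_pair scale scale ..
    show ?thesis by (rule p.linear_independent_injective_image[OF f B(2)]) (simp add: spB inj)
  qed
  have card: "card (f ` B) = card B"
    by (rule card_image[OF inj_on_subset[OF inj B(1)]])
  have "W \<subseteq> span (f ` B)"
  proof (rule ccontr)
    assume "\<not> W \<subseteq> span (f ` B)"
    then obtain y where y: "y \<in> W" "y \<notin> span (f ` B)" by blast
    have "card (insert y (f ` B)) \<le> card B"
    proof (rule conjunct2[OF independent_span_bound[OF \<open>finite B\<close>]])
      show "independent (insert y (f ` B))" by (rule independent_insertI[OF y(2) ind])
      show "insert y (f ` B) \<subseteq> span B" unfolding spB using y(1) into B(1) by blast
    qed
    moreover have "y \<notin> f ` B" using y(2) span_base by blast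
    ultimately show False using card \<open>finite B\<close> by simp
  qed
  also have "span (f ` B) = f ` W"
    unfolding spB[symmetric] by (rule module_hom.span_image[OF f[folded module_hom_iff_linear]])
  finally show "W \<subseteq> f ` W" .
qed

locale finite_basis = vector_space scale
  for scale :: "'k::field \<Rightarrow> 'v::ab_group_add \<Rightarrow> 'v" (infixr \<open>*s\<close> 75) +
  fixes B :: "'v set"
  assumes finite_B: "finite B" and independent_B: "independent B" and span_B: "span B = UNIV"
begin

definition coord :: "'v \<Rightarrow> 'v \<Rightarrow> 'k" where
  "coord b x = representation B x b"

lemma coord_add: "coord b (x + y) = coord b x + coord b y"
  by (simp add: coord_def representation_add independent_B span_B)

lemma coord_scale: "coord b (c *s x) = c * coord b x"
  by (simp add: coord_def representation_scale independent_B span_B)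

lemma coord_zero [simp]: "coord b 0 = 0"
  using coord_scale[of b 0 0] by simp

lemma coord_sum: "coord b (sum f I) = (\<Sum>i\<in>I. coord b (f i))"
  by (induction I rule: infinite_finite_induct) (auto simp: coord_add)

lemma linear_coord: "Vector_Spaces.linear scale (*) (coord b)"
  using vector_space_axioms vector_space_times
  by (simp add: Vector_Spaces.linear_iff coord_add coord_scale)

lemma sum_coord: "(\<Sum>b\<in>B. coord b x *s b) = x"
  unfolding coord_def
  by (rule sum_representation_eq) (auto simp: independent_B span_B finite_B)

lemma coord_basis: "b \<in> B \<Longrightarrow> coord c b = (if c = b then 1 else 0)"
  by (auto simp: coord_def representation_basis independent_B)

lemma coord_inject: "(\<And>b. b \<in> B \<Longrightarrow> coord b x = coord b y) \<Longrightarrow> x = y"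
  by (subst sum_coord[of x, symmetric], subst sum_coord[of y, symmetric]) (simp cong: sum.cong)

lemma linear_expand:
  assumes "Vector_Spaces.linear scale sU f"
  shows "f x = (\<Sum>b\<in>B. sU (coord b x) (f b))"
proof -
  interpret f: Vector_Spaces.linear scale sU f by fact
  have "f x = f (\<Sum>b\<in>B. coord b x *s b)" by (simp add: sum_coord)
  then show ?thesis by (simp add: f.sum f.scale)
qed

lemma linear_eq_on_basis:
  assumes "Vector_Spaces.linear scale sU f" "Vector_Spaces.linear scale sU g"
    and "\<And>b. b \<in> B \<Longrightarrow> f b = g b"
  shows "f x = g x"
  unfolding linear_expand[OF assms(1), of x] linear_expand[OF assms(2), of x]
  by (intro sum.cong) (simp_all add: assms(3))

text \<open>
  The endomorphisms form a subspace of the space of all maps, finite dimensional because it is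
  spanned by the elementary maps \<open>x \<mapsto> coord b x *s c\<close>; so injectivity implies surjectivity.
\<close>

lemma inj_linear_on_End:
  assumes f: "Vector_Spaces.linear (fun_scale scale) (fun_scale scale) f"
    and into: "\<And>g. Vector_Spaces.linear scale scale g \<Longrightarrow> Vector_Spaces.linear scale scale (f g)"
    and inj: "\<And>g. Vector_Spaces.linear scale scale g \<Longrightarrow> f g = 0 \<Longrightarrow> g = 0"
    and h: "Vector_Spaces.linear scale scale h"
  obtains g where "Vector_Spaces.linear scale scale g" "f g = h"
proof -
  let ?L = "{g. Vector_Spaces.linear scale scale g}"
  let ?E = "{\<lambda>x. coord b x *s c | b c. b \<in> B \<and> c \<in> B}"
  interpret F: vector_space "fun_scale scale :: 'k \<Rightarrow> ('v \<Rightarrow> 'v) \<Rightarrow> 'v \<Rightarrow> 'v"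
    by (rule vector_space_fun_scale[OF vector_space_axioms])
  interpret f: Vector_Spaces.linear "fun_scale scale" "fun_scale scale" f by fact
  have sub: "F.subspace ?L"
  proof (rule F.subspaceI)
    show "0 \<in> ?L" using vector_space_axioms by (simp add: Vector_Spaces.linear_iff)
  next
    fix g g' assume "g \<in> ?L" "g' \<in> ?L"
    then show "g + g' \<in> ?L"
      by (simp add: Vector_Spaces.linear_iff scale_right_distrib add.assoc add.left_commute)
  next
    fix c g assume "g \<in> ?L"
    then show "fun_scale scale c g \<in> ?L"
      by (simp add: Vector_Spaces.linear_iff fun_scale_def scale_right_distrib mult.commute)
  qed
  have sp: "?L \<subseteq> F.span ?E"
  proof
    fix g assume "g \<in> ?L"
    then have g: "Vector_Spaces.linear scale scale g" by simp
    have g_eq: "g = (\<Sum>(b, c)\<in>B \<times> B. fun_scale scale (coord c (g b)) (\<lambda>x. coord b x *s c))"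
    proof
      fix x
      have "g x = (\<Sum>b\<in>B. coord b x *s (\<Sum>c\<in>B. coord c (g b) *s c))"
        by (subst linear_expand[OF g]) (simp only: sum_coord)
      also have "\<dots> = (\<Sum>b\<in>B. \<Sum>c\<in>B. coord c (g b) *s (coord b x *s c))"
        unfolding scale_sum_right by (intro sum.cong refl scale_left_commute)
      also have "\<dots> = (\<Sum>(b, c)\<in>B \<times> B. fun_scale scale (coord c (g b)) (\<lambda>x. coord b x *s c) x)"
        by (simp add: sum.cartesian_product fun_scale_def)
      also have "\<dots> = (\<Sum>(b, c)\<in>B \<times> B. fun_scale scale (coord c (g b)) (\<lambda>x. coord b x *s c)) x"
        by (subst sum_fun_apply) (intro sum.cong refl, auto)
      finally show "g x = \<dots>" .
    qed
    show "g \<in> F.span ?E"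
    proof (subst g_eq, rule F.span_sum)
      fix p assume p: "p \<in> B \<times> B"
      obtain b c where bc: "p = (b, c)" by (cases p)
      then have "b \<in> B" "c \<in> B" using p by simp_all
      then have E: "(\<lambda>x. coord b x *s c) \<in> ?E" by blast
      show "(case p of (b, c) \<Rightarrow> fun_scale scale (coord c (g b)) (\<lambda>x. coord b x *s c)) \<in> F.span ?E"
        unfolding bc prod.case by (rule F.span_scale[OF F.span_base[OF E]])
    qed
  qed
  have "f ` ?L = ?L"
  proof (rule F.inj_linear_image_subspace[OF f sub _ sp])
    show "finite ?E" by (rule finite_image_set2) (simp_all add: finite_B)
    show "f ` ?L \<subseteq> ?L" using into by blast
    show "inj_on f ?L"
    proof (rule inj_onI)
      fix g g' assume gg: "g \<in> ?L" "g' \<in> ?L" "f g = f g'"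
      have "g - g' \<in> ?L" by (rule F.subspace_diff[OF sub gg(1,2)])
      then have "g - g' = 0" using gg(3) inj[of "g - g'"] f.diff[of g g'] by force
      then show "g = g'" by (rule right_minus_eq[THEN iffD1])
    qed
  qed
  then have "h \<in> f ` ?L" using h by blast
  then show ?thesis using that by blast
qed

end

lemma finite_basis_exists:
  assumes "vector_space s" "finite_dim s"
  obtains B where "finite_basis s B"
proof -
  interpret vector_space s by fact
  obtain F where F: "finite F" "span F = UNIV" using assms(2) unfolding finite_dim_def by blast
  obtain B where "B \<subseteq> UNIV" "independent B" "UNIV \<subseteq> span B"
    using maximal_independent_subset by blast
  moreover have "finite B"
    using independent_span_bound[OF F(1) \<open>independent B\<close>] F(2) by simp
  ultimately have "finite_basis s B" by unfold_locales auto
  then show ?thesis by (rule that)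
qed

lemma finite_basis_exists_containing:
  assumes "vector_space s" "finite_dim s" "e \<noteq> 0"
  obtains B where "finite_basis s B" "e \<in> B"
proof -
  interpret vector_space s by fact
  obtain F where F: "finite F" "span F = UNIV" using assms(2) unfolding finite_dim_def by blast
  have ind: "independent {e}" using assms(3) by (simp add: dependent_single)
  let ?B = "extend_basis {e}"
  have B: "independent ?B" "span ?B = UNIV" "e \<in> ?B"
    using independent_extend_basis[OF ind] span_extend_basis[OF ind] extend_basis_superset[OF ind]
    by auto
  moreover have "finite ?B"
    using independent_span_bound[OF F(1) B(1)] F(2) by simp
  ultimately have "finite_basis s ?B" by unfold_locales auto
  then show ?thesis using B(3) by (rule that)
qed


section \<open>Calculating with the comultiplication\<close>

lemma linear_on_sum_list:
  assumes L: "linear_on sU U sW L" and sU: "vector_space sU" "Modules.module.subspace sU U"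
    and sW: "vector_space sW" and xs: "\<And>x. x \<in> set xs \<Longrightarrow> f x \<in> U"
  shows "(\<Sum>x\<leftarrow>xs. f x) \<in> U \<and> L (\<Sum>x\<leftarrow>xs. f x) = (\<Sum>x\<leftarrow>xs. L (f x))"
proof -
  interpret U: vector_space sU by fact
  interpret W: vector_space sW by fact
  have "L (sU 0 0) = sW 0 (L 0)" using L U.subspace_0[OF sU(2)] unfolding linear_on_def by blast
  then have L0: "L 0 = 0" by simp
  show ?thesis using xs
  proof (induction xs)
    case Nil
    then show ?case by (simp add: L0 U.subspace_0[OF sU(2)])
  next
    case (Cons x xs)
    then have "f x \<in> U" "(\<Sum>x\<leftarrow>xs. f x) \<in> U" "L (\<Sum>x\<leftarrow>xs. f x) = (\<Sum>x\<leftarrow>xs. L (f x))" by auto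
    then show ?case using L by (simp add: U.subspace_add[OF sU(2)] linear_on_def)
  qed
qed

lemma linear_on_tensor_lift:
  assumes L: "linear_on sU U sW L" and sU: "vector_space sU" "Modules.module.subspace sU U"
    and sW: "vector_space sW" and f: "bilinear_on sX X sY Y sU f"
    and fU: "\<And>x y. x \<in> X \<Longrightarrow> y \<in> Y \<Longrightarrow> f x y \<in> U"
    and g: "\<And>x y. x \<in> X \<Longrightarrow> y \<in> Y \<Longrightarrow> g x y = L (f x y)"
    and gb: "bilinear_on sX X sY Y sW g"
    and t: "t \<in> tensor_space sX X sY Y"
  shows "L (tensor_lift sX X sY Y f t) = tensor_lift sX X sY Y g t"
proof -
  obtain xs where xs: "t = (\<Sum>(x, y)\<leftarrow>xs. tensor sX X sY Y x y)" "set xs \<subseteq> X \<times> Y"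
    using t unfolding tensor_space_def by blast
  have "L (tensor_lift sX X sY Y f t) = L (\<Sum>p\<leftarrow>xs. case p of (x, y) \<Rightarrow> f x y)"
    unfolding xs(1) by (simp only: tensor_lift_sum_list[OF sU(1) f xs(2)])
  also have "\<dots> = (\<Sum>p\<leftarrow>xs. L (case p of (x, y) \<Rightarrow> f x y))"
    by (rule conjunct2[OF linear_on_sum_list[OF L sU sW]]) (use xs(2) fU in auto)
  also have "\<dots> = (\<Sum>(x, y)\<leftarrow>xs. g x y)"
    by (rule arg_cong[where f = sum_list], rule map_cong) (use xs(2) g in auto)
  also have "\<dots> = tensor_lift sX X sY Y g t"
    unfolding xs(1) by (simp only: tensor_lift_sum_list[OF sW gb xs(2)])
  finally show ?thesis .
qed

lemma tensor_lift_cong: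
  assumes sU: "vector_space sU" and f: "bilinear_on sX X sY Y sU f"
    and fg: "\<And>x y. x \<in> X \<Longrightarrow> y \<in> Y \<Longrightarrow> f x y = g x y" and g: "bilinear_on sX X sY Y sU g"
    and t: "t \<in> tensor_space sX X sY Y"
  shows "tensor_lift sX X sY Y f t = tensor_lift sX X sY Y g t"
proof -
  interpret U: vector_space sU by fact
  show ?thesis
    by (rule linear_on_tensor_lift[where L = "\<lambda>u. u", OF _ sU U.subspace_UNIV sU f _ _ g t])
      (simp_all add: linear_on_def fg)
qed

definition trilinear_on ::
    "('k::field \<Rightarrow> 'v::ab_group_add \<Rightarrow> 'v) \<Rightarrow> 'v set \<Rightarrow> ('k \<Rightarrow> 'u::ab_group_add \<Rightarrow> 'u)
      \<Rightarrow> ('v \<Rightarrow> 'v \<Rightarrow> 'v \<Rightarrow> 'u) \<Rightarrow> bool" where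
  "trilinear_on sV V sU f \<longleftrightarrow> (\<forall>z\<in>V. bilinear_on sV V sV V sU (\<lambda>x y. f x y z)) \<and>
    (\<forall>x\<in>V. \<forall>y\<in>V. linear_on sV V sU (f x y))"

context hopf_algebra
begin

abbreviation sw :: "('v \<Rightarrow> 'v \<Rightarrow> 'u::ab_group_add) \<Rightarrow> 'v \<Rightarrow> 'u" where
  "sw f h \<equiv> tensor_lift scale V scale V f (comul h)"

lemma linear_on_sw:
  assumes "vector_space sU" and f: "bilinear_on scale V scale V sU f"
  shows "linear_on scale V sU (sw f)"
  using tensor_universal_property(1)[OF vector_space_axioms subspace_V assms]
    comul_linear comul_closed
  unfolding linear_on_def by simp

lemma tensor_lift_parameter:
  assumes sU: "vector_space sU" and t: "t \<in> tensor_space scale V scale V"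
    and f: "\<And>z. z \<in> V \<Longrightarrow> bilinear_on scale V scale V sU (f z)"
    and lin: "\<And>x y. x \<in> V \<Longrightarrow> y \<in> V \<Longrightarrow> linear_on scale V sU (\<lambda>z. f z x y)"
  shows "linear_on scale V sU (\<lambda>z. tensor_lift scale V scale V (f z) t)"
proof -
  interpret U: vector_space sU by fact
  obtain xs where xs: "t = (\<Sum>(x, y)\<leftarrow>xs. tensor scale V scale V x y)" "set xs \<subseteq> V \<times> V"
    using t unfolding tensor_space_def by blast
  have *: "tensor_lift scale V scale V (f z) t = (\<Sum>(x, y)\<leftarrow>xs. f z x y)" if "z \<in> V" for z
    unfolding xs(1) by (simp only: tensor_lift_sum_list[OF sU f[OF that] xs(2)])
  have add: "(\<Sum>(x, y)\<leftarrow>xs. f (z + z') x y) = (\<Sum>(x, y)\<leftarrow>xs. f z x y) + (\<Sum>(x, y)\<leftarrow>xs. f z' x y)"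
    if "z \<in> V" "z' \<in> V" for z z'
    using xs(2) that by (induction xs) (use lin in \<open>auto simp: linear_on_def\<close>)
  have scl: "(\<Sum>(x, y)\<leftarrow>xs. f (scale c z) x y) = sU c (\<Sum>(x, y)\<leftarrow>xs. f z x y)" if "z \<in> V" for z c
    using xs(2) that
    by (induction xs) (use lin in \<open>auto simp: linear_on_def U.scale_right_distrib\<close>)
  show ?thesis
    unfolding linear_on_def
    using add scl by (simp add: * subspace_add[OF subspace_V] subspace_scale[OF subspace_V])
qed

lemma trilinear_sw_left:
  assumes sU: "vector_space sU" and f: "trilinear_on scale V sU f"
  shows "bilinear_on scale V scale V sU (\<lambda>x z. sw (\<lambda>x' x''. f x' x'' z) x)"
  unfolding bilinear_on_def using f
  by (auto simp: trilinear_on_def intro!: linear_on_sw[OF sU] tensor_lift_parameter[OF sU comul_closed])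

lemma trilinear_sw_right:
  assumes sU: "vector_space sU" and f: "trilinear_on scale V sU f"
  shows "bilinear_on scale V scale V sU (\<lambda>x y. sw (\<lambda>y' y''. f x y' y'') y)"
proof -
  have "bilinear_on scale V scale V sU (f x)" if "x \<in> V" for x
    using f that by (auto simp: trilinear_on_def bilinear_on_def)
  then show ?thesis
    unfolding bilinear_on_def[of scale V scale V sU "\<lambda>x y. sw (\<lambda>y' y''. f x y' y'') y"]
    using f
    by (auto simp: trilinear_on_def bilinear_on_def
        intro!: linear_on_sw[OF sU] tensor_lift_parameter[OF sU comul_closed])
qed

text \<open>
  Coassociativity as it is used: the axiom compares elements of \<open>(V \<otimes> V) \<otimes> V\<close>, and a trilinear
  map is a linear map on that space.
\<close>

lemma coassoc_trilinear:
  assumes sU: "vector_space sU" and f: "trilinear_on scale V sU f" and h: "h \<in> V"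
  shows "sw (\<lambda>x z. sw (\<lambda>x' x''. f x' x'' z) x) h = sw (\<lambda>x y. sw (\<lambda>y' y''. f x y' y'') y) h"
proof -
  let ?T = "tensor_space scale V scale V"
  let ?s = "fun_scale (*) :: 'k \<Rightarrow> (('v \<Rightarrow> 'v \<Rightarrow> 'k) \<Rightarrow> 'k) \<Rightarrow> (('v \<Rightarrow> 'v \<Rightarrow> 'k) \<Rightarrow> 'k)"
  let ?s3 = "fun_scale (*) :: 'k \<Rightarrow> (((('v \<Rightarrow> 'v \<Rightarrow> 'k) \<Rightarrow> 'k) \<Rightarrow> 'v \<Rightarrow> 'k) \<Rightarrow> 'k) \<Rightarrow> _"
  let ?T3 = "tensor_space ?s ?T scale V"
  let ?t = "tensor ?s ?T scale V"
  let ?g = "\<lambda>t z. tensor_lift scale V scale V (\<lambda>x y. f x y z) t"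
  let ?G = "tensor_lift ?s ?T scale V ?g"
  have s: "vector_space ?s" and s3: "vector_space ?s3"
    by (rule vector_space_fun_scale[OF vector_space_times])+
  have T: "Modules.module.subspace ?s ?T"
    by (rule subspace_tensor_space[OF vector_space_axioms subspace_V])
  have T3: "Modules.module.subspace ?s3 ?T3"
    by (rule subspace_tensor_space[OF s T])
  have fb: "bilinear_on scale V scale V sU (\<lambda>x y. f x y z)" if "z \<in> V" for z
    using f that by (auto simp: trilinear_on_def)
  have fl: "linear_on scale V sU (f x y)" if "x \<in> V" "y \<in> V" for x y
    using f that by (auto simp: trilinear_on_def)
  have g: "bilinear_on ?s ?T scale V sU ?g"
    unfolding bilinear_on_def[of ?s]
    using tensor_universal_property(1)[OF vector_space_axioms subspace_V sU fb]
      tensor_lift_parameter[OF sU, of _ "\<lambda>z x y. f x y z"] fb fl by auto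
  have G: "linear_on ?s3 ?T3 sU ?G"
    by (rule tensor_universal_property(1)[OF s T sU g])
  have Gt: "?G (?t t z) = ?g t z" if "t \<in> ?T" "z \<in> V" for t z
    by (rule tensor_universal_property(2)[OF s T sU g that])
  have tb: "bilinear_on ?s ?T scale V ?s3 ?t" by (rule bilinear_tensor)
  have pb: "bilinear_on scale V scale V ?s (tensor scale V scale V)" by (rule bilinear_tensor)
  have t_tri: "trilinear_on scale V ?s3 (\<lambda>x y z. ?t (tensor scale V scale V x y) z)"
    using tb pb tensor_in_tensor_space[of _ V _ V scale scale]
    unfolding trilinear_on_def bilinear_on_def linear_on_def
    by (auto simp: subspace_add[OF subspace_V] subspace_scale[OF subspace_V])
  have "?G (sw (\<lambda>x y. ?t (comul x) y) h) = sw (\<lambda>x z. sw (\<lambda>x' x''. f x' x'' z) x) h"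
  proof (rule linear_on_tensor_lift[OF G s3 T3 sU])
    show "bilinear_on scale V scale V ?s3 (\<lambda>x y. ?t (comul x) y)"
      using tb comul_linear comul_closed unfolding bilinear_on_def linear_on_def by auto
  qed (auto simp: Gt comul_closed h intro!: tensor_in_tensor_space trilinear_sw_left[OF sU f])
  moreover have "?G (sw (\<lambda>x y. sw (\<lambda>y' y''. ?t (tensor scale V scale V x y') y'') y) h)
      = sw (\<lambda>x y. sw (\<lambda>y' y''. f x y' y'') y) h"
  proof (rule linear_on_tensor_lift[OF G s3 T3 sU])
    show "bilinear_on scale V scale V ?s3 (\<lambda>x y. sw (\<lambda>y' y''. ?t (tensor scale V scale V x y') y'') y)"
      by (rule trilinear_sw_right[OF s3 t_tri])
    show "bilinear_on scale V scale V sU (\<lambda>x y. sw (\<lambda>y' y''. f x y' y'') y)"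
      by (rule trilinear_sw_right[OF sU f])
    fix x y assume xy: "x \<in> V" "y \<in> V"
    have ib: "bilinear_on scale V scale V ?s3 (\<lambda>y' y''. ?t (tensor scale V scale V x y') y'')"
      using t_tri xy unfolding trilinear_on_def bilinear_on_def by auto
    have ifb: "bilinear_on scale V scale V sU (\<lambda>y' y''. f x y' y'')"
      using f xy unfolding trilinear_on_def bilinear_on_def by auto
    have it: "?t (tensor scale V scale V x y') y'' \<in> ?T3" if "y' \<in> V" "y'' \<in> V" for y' y''
      using that xy by (auto intro!: tensor_in_tensor_space)
    show "sw (\<lambda>y' y''. f x y' y'') y = ?G (sw (\<lambda>y' y''. ?t (tensor scale V scale V x y') y'') y)"
      by (rule sym, rule linear_on_tensor_lift[OF G s3 T3 sU ib it _ ifb])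
        (auto simp: Gt xy tensor_in_tensor_space comul_closed
          tensor_universal_property(2)[OF vector_space_axioms subspace_V sU fb])
    obtain xs where xs: "comul y = (\<Sum>(x, y)\<leftarrow>xs. tensor scale V scale V x y)" "set xs \<subseteq> V \<times> V"
      using comul_closed[OF xy(2)] unfolding tensor_space_def by blast
    have "(\<Sum>p\<leftarrow>xs. case p of (y', y'') \<Rightarrow> ?t (tensor scale V scale V x y') y'') \<in> ?T3"
      by (rule conjunct1[OF linear_on_sum_list[OF G s3 T3 sU]]) (use xs(2) it in auto)
    then show "sw (\<lambda>y' y''. ?t (tensor scale V scale V x y') y'') y \<in> ?T3"
      unfolding xs(1) by (simp only: tensor_lift_sum_list[OF s3 ib xs(2)])
  qed (rule comul_closed[OF h])
  ultimately show ?thesis using coassoc[OF h] by simp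
qed

end

context module_algebra
begin

lemma act_linear_on: "a \<in> V \<Longrightarrow> Vector_Spaces.linear sA sA (act a)"
  using act_bilinear alg.vector_space_axioms
  by (auto simp: bilinear_on_def linear_on_def Vector_Spaces.linear_iff)

lemma act_add_left: "\<lbrakk>g \<in> V; h \<in> V\<rbrakk> \<Longrightarrow> act (g + h) a = act g a + act h a"
  and act_scale_left: "h \<in> V \<Longrightarrow> act (scale c h) a = sA c (act h a)"
  and act_add: "h \<in> V \<Longrightarrow> act h (a + b) = act h a + act h b"
  and act_scale: "h \<in> V \<Longrightarrow> act h (sA c a) = sA c (act h a)"
  using act_bilinear by (auto simp: bilinear_on_def linear_on_def)

lemma alg_scale_mult: "sA c a * b = sA c (a * b)" "a * sA c b = sA c (a * b)"
  using alg.mul_bilinear by (auto simp: bilinear_on_def linear_on_def)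

lemma antipode_add: "\<lbrakk>g \<in> V; h \<in> V\<rbrakk> \<Longrightarrow> antipode (g + h) = antipode g + antipode h"
  and antipode_scale: "h \<in> V \<Longrightarrow> antipode (scale c h) = scale c (antipode h)"
  using antipode_linear by (auto simp: linear_on_def)

lemma counit_add: "\<lbrakk>g \<in> V; h \<in> V\<rbrakk> \<Longrightarrow> counit (g + h) = counit g + counit h"
  and counit_scale: "h \<in> V \<Longrightarrow> counit (scale c h) = c * counit h"
  using counit_linear by (auto simp: linear_on_def)

lemmas act_linear_simps = act_add_left act_scale_left act_add act_scale alg_scale_mult
  antipode_add antipode_scale antipode_closed distrib_left distrib_right alg.scale_right_distrib
  alg.scale_left_distrib counit_add counit_scale mul_closed
  subspace_add[OF subspace_V] subspace_scale[OF subspace_V]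

text \<open>
  Both factors of a product can be acted on at once; the antipode cancels the action on the
  second factor.  In Sweedler notation, \<open>h' (a (S h'' c)) = (h' a) (h'' (S h''' c)) = (h a) c\<close>.
\<close>

lemma act_times:
  assumes h: "h \<in> V"
  shows "act h a * c = sw (\<lambda>x y. act x (a * act (antipode y) c)) h"
proof -
  note vA = alg.vector_space_axioms
  have mul_lin: "mul (x + y) z = mul x z + mul y z" "mul z (x + y) = mul z x + mul z y"
    "mul (scale k x) z = scale k (mul x z)" "mul z (scale k x) = scale k (mul z x)"
    if "x \<in> V" "y \<in> V" "z \<in> V" for x y z k
    using mul_bilinear that by (auto simp: bilinear_on_def linear_on_def)
  let ?f = "\<lambda>x y z. act x a * act y (act (antipode z) c)"
  have f: "trilinear_on scale V sA ?f"
    by (auto simp: trilinear_on_def bilinear_on_def linear_on_def act_linear_simps)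
  have step: "sw (\<lambda>y' y''. ?f x y' y'') y = sA (counit y) (act x a * c)" if "x \<in> V" "y \<in> V" for x y
  proof -
    have "act x a * act (sw (\<lambda>y' y''. mul y' (antipode y'')) y) c = sw (\<lambda>y' y''. ?f x y' y'') y"
      by (rule linear_on_tensor_lift[where L = "\<lambda>h. act x a * act h c" and U = V,
            OF _ vector_space_axioms subspace_V vA])
        (auto simp: bilinear_on_def linear_on_def act_linear_simps mul_lin act_mul that comul_closed)
    then show ?thesis using that by (simp add: antipode_right act_linear_simps e_closed act_e)
  qed
  have "sw (\<lambda>x y. act x (a * act (antipode y) c)) h = sw (\<lambda>x z. sw (\<lambda>x' x''. ?f x' x'' z) x) h"
  proof (rule tensor_lift_cong[OF vA _ _ trilinear_sw_left[OF vA f] comul_closed[OF h]])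
    show "bilinear_on scale V scale V sA (\<lambda>x y. act x (a * act (antipode y) c))"
      by (auto simp: bilinear_on_def linear_on_def act_linear_simps)
  qed (simp add: act_prod)
  also have "\<dots> = sw (\<lambda>x y. sw (\<lambda>y' y''. ?f x y' y'') y) h"
    by (rule coassoc_trilinear[OF vA f h])
  also have "\<dots> = sw (\<lambda>x y. sA (counit y) (act x a * c)) h"
    by (rule tensor_lift_cong[OF vA trilinear_sw_right[OF vA f] step _ comul_closed[OF h]])
      (auto simp: bilinear_on_def linear_on_def act_linear_simps mult.commute)
  also have "\<dots> = act (sw (\<lambda>x y. scale (counit y) x) h) a * c"
    by (rule sym, rule linear_on_tensor_lift[where L = "\<lambda>h. act h a * c" and U = V,
            OF _ vector_space_axioms subspace_V vA])
      (auto simp: bilinear_on_def linear_on_def act_linear_simps comul_closed h mult.commute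
        scale_right_distrib scale_left_distrib)
  finally show ?thesis using h by (simp add: counit_right)
qed

text \<open>
  Applying an invariant form to the previous formula removes the outer action.  So the antipode
  is the adjoint with respect to the bilinear form given by an invariant linear form.
\<close>

lemma invariant_form_antipode:
  assumes t: "Vector_Spaces.linear sA (*) t" and inv: "\<And>h a. h \<in> V \<Longrightarrow> t (act h a) = counit h * t a"
    and h: "h \<in> V"
  shows "t (act h a * c) = t (a * act (antipode h) c)"
proof -
  interpret t: Vector_Spaces.linear sA "(*)" t by fact
  have "t (act h a * c) = sw (\<lambda>x y. t (act x (a * act (antipode y) c))) h"
    unfolding act_times[OF h]
    by (rule linear_on_tensor_lift[where U = UNIV, OF _ alg.vector_space_axioms _ vector_space_times])
      (auto simp: bilinear_on_def linear_on_def act_linear_simps t.add t.scale comul_closed h)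
  also have "\<dots> = sw (\<lambda>x y. t (a * act (antipode (scale (counit x) y)) c)) h"
    by (rule tensor_lift_cong[OF vector_space_times])
      (auto simp: bilinear_on_def linear_on_def act_linear_simps t.add t.scale comul_closed h inv
        mult.left_commute)
  also have "\<dots> = t (a * act (antipode (sw (\<lambda>x y. scale (counit x) y) h)) c)"
    by (rule sym, rule linear_on_tensor_lift[where L = "\<lambda>h. t (a * act (antipode h) c)" and U = V,
          OF _ vector_space_axioms subspace_V vector_space_times])
      (auto simp: bilinear_on_def linear_on_def act_linear_simps t.add t.scale comul_closed h
        scale_right_distrib scale_left_distrib mult.left_commute)
  finally show ?thesis using h by (simp add: counit_left)
qed

end


section \<open>Central simple algebras\<close>

locale central_simple_algebra = finite_basis scale B
  for scale :: "'k::field \<Rightarrow> 'a::ring_1 \<Rightarrow> 'a" (infixr \<open>*s\<close> 75) and B +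
  assumes scale_mult_left: "(c *s a) * b = c *s (a * b)"
    and scale_mult_right: "a * (c *s b) = c *s (a * b)"
    and one_B: "1 \<in> B"
    and central: "(\<And>a. z * a = a * z) \<Longrightarrow> z \<in> range (\<lambda>c. c *s 1)"
    and simple: "two_sided_ideal (I :: 'a set) \<Longrightarrow> I = {0} \<or> I = UNIV"
begin

lemma coord_one: "coord 1 1 = 1"
  by (simp add: coord_basis one_B)

lemma coord_scalar: "coord 1 (c *s 1) = c"
  by (simp add: coord_scale coord_one)

lemma scalar_coord: "(\<And>a. z * a = a * z) \<Longrightarrow> coord 1 z *s 1 = z"
  using central[of z] by (auto simp: coord_scalar)

lemma scalar_commute: "(c *s 1) * a = a * (c *s 1)"
  by (simp add: scale_mult_left scale_mult_right)

lemma zero_or_unit_ideal: "two_sided_ideal (I :: 'a set) \<Longrightarrow> x \<in> I \<Longrightarrow> x \<noteq> 0 \<Longrightarrow> y \<in> I"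
  using simple[of I] by auto

text \<open>
  The operators \<open>x \<mapsto> p x e\<close> are independent for different basis elements \<open>e\<close>.  The coefficients
  of a fixed \<open>e\<^sub>0\<close> in all relations among them form a two-sided ideal.  If it were everything,
  there would be a relation with coefficient \<open>1\<close> at \<open>e\<^sub>0\<close>; its commutators with elements of the
  algebra are shorter relations, so its coefficients are central and \<open>x = 1\<close> gives a linear
  dependence among the \<open>e\<close>.
\<close>

lemma sandwich_independent_aux:
  assumes "finite I" "I \<subseteq> B" "\<And>x. (\<Sum>e\<in>I. p e * x * e) = 0" "e \<in> I"
  shows "p e = 0"
  using assms
proof (induction I arbitrary: p e rule: finite_induct)
  case (insert e0 I)
  note IH = insert.IH[OF subset_trans[OF subset_insertI insert.prems(1)]]
  let ?R = "\<lambda>q. \<forall>x. (\<Sum>e\<in>insert e0 I. q e * x * e) = 0"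
  define J where "J = {q e0 | q. ?R q}"
  have J: "two_sided_ideal J"
    unfolding two_sided_ideal_def
  proof (intro conjI ballI allI)
    show "0 \<in> J" unfolding J_def by (intro CollectI exI[of _ "\<lambda>_. 0"]) simp
    fix y assume "y \<in> J"
    then obtain q where q: "?R q" "y = q e0" unfolding J_def by blast
    show "a * y \<in> J" for a
    proof -
      have "(\<Sum>e\<in>insert e0 I. a * q e * x * e) = a * (\<Sum>e\<in>insert e0 I. q e * x * e)" for x
        by (simp only: sum_distrib_left mult.assoc)
      then have "?R (\<lambda>e. a * q e)" using q(1) by simp
      then show ?thesis unfolding J_def q(2) by (intro CollectI exI[of _ "\<lambda>e. a * q e"]) simp
    qed
    show "y * a \<in> J" for a
    proof -
      have "(\<Sum>e\<in>insert e0 I. q e * a * x * e) = 0" for x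
        using q(1)[rule_format, of "a * x"] by (simp only: mult.assoc)
      then have "?R (\<lambda>e. q e * a)" by blast
      then show ?thesis unfolding J_def q(2) by (intro CollectI exI[of _ "\<lambda>e. q e * a"]) simp
    qed
    fix z assume "z \<in> J"
    then obtain r where r: "?R r" "z = r e0" unfolding J_def by blast
    have "?R (\<lambda>e. q e + r e)"
      using q(1) r(1) by (simp only: distrib_right sum.distrib) simp
    then show "y + z \<in> J"
      unfolding J_def q(2) r(2) by (intro CollectI exI[of _ "\<lambda>e. q e + r e"]) simp
  qed
  have "1 \<notin> J"
  proof
    assume "1 \<in> J"
    then obtain q where q: "?R q" "q e0 = 1" unfolding J_def by force
    \<comment> \<open>the relation solved for its term at \<open>e0\<close>\<close>
    have qx: "x * e0 = - (\<Sum>e\<in>I. q e * x * e)" for x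
      using q insert.hyps by (simp add: eq_neg_iff_add_eq_0)
    have "y * q e - q e * y = 0" if "e \<in> I" for e y
    proof (rule IH[of "\<lambda>e. y * q e - q e * y", OF _ that])
      fix x
      have "(\<Sum>e\<in>I. (y * q e - q e * y) * x * e)
          = y * (\<Sum>e\<in>I. q e * x * e) - (\<Sum>e\<in>I. q e * (y * x) * e)"
        by (simp add: left_diff_distrib sum_subtractf sum_distrib_left mult.assoc)
      also have "\<dots> = 0"
        using qx[of x] qx[of "y * x"] by (simp add: mult.assoc)
      finally show "(\<Sum>e\<in>I. (y * q e - q e * y) * x * e) = 0" .
    qed
    then have c: "coord 1 (q e) *s 1 = q e" if "e \<in> I" for e
      using scalar_coord[of "q e"] that by simp
    have "1 = coord e0 e0" using insert.prems(1) by (simp add: coord_basis)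
    also have "\<dots> = - coord e0 (\<Sum>e\<in>I. q e * e)"
      using qx[of 1] coord_scale[of e0 "-1"] by simp
    also have "(\<Sum>e\<in>I. q e * e) = (\<Sum>e\<in>I. coord 1 (q e) *s e)"
      by (intro sum.cong refl) (metis c mult_1_left scale_mult_left)
    also have "coord e0 \<dots> = (\<Sum>e\<in>I. 0 :: 'k)"
      unfolding coord_sum
    proof (intro sum.cong refl)
      fix e assume "e \<in> I"
      then have "e \<in> B" "e0 \<noteq> e" using insert.hyps(2) insert.prems(1) by auto
      then show "coord e0 (coord 1 (q e) *s e) = 0" by (simp add: coord_scale coord_basis)
    qed
    finally show False by simp
  qed
  then have "p e0 = 0"
  proof -
    have "p e0 \<in> J" unfolding J_def using insert.prems(2) by (intro CollectI exI[of _ p]) simp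
    then show ?thesis using zero_or_unit_ideal[OF J, of "p e0" 1] \<open>1 \<notin> J\<close> by blast
  qed
  moreover have "p e = 0" if "e \<in> I" for e
    using IH[of p e] that \<open>p e0 = 0\<close> insert.prems(2) insert.hyps by simp
  ultimately show ?case using insert.prems(3) by auto
qed simp

lemma sandwich_independent:
  "(\<And>x. (\<Sum>e\<in>B. p e * x * e) = 0) \<Longrightarrow> e \<in> B \<Longrightarrow> p e = 0"
  using sandwich_independent_aux[OF finite_B subset_refl] by blast

lemma sandwich_unique:
  assumes "\<And>x. (\<Sum>e\<in>B. p e * x * e) = (\<Sum>e\<in>B. q e * x * e)" "e \<in> B"
  shows "p e = q e"
  using sandwich_independent[of "\<lambda>e. p e - q e" e] assms
  by (simp add: left_diff_distrib sum_subtractf)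

text \<open>
  A family \<open>p\<close> indexed by the basis is the same as a linear endomorphism of \<open>A\<close>.  So the
  map from \<open>p\<close> to the operator \<open>x \<mapsto> (\<Sum>e\<in>B. p e * x * e)\<close> is an injective endomorphism of the
  finite dimensional space \<open>End A\<close>, hence onto.
\<close>

lemma sandwich_exists:
  assumes T: "Vector_Spaces.linear scale scale T"
  obtains p where "\<And>x. T x = (\<Sum>e\<in>B. p e * x * e)"
proof -
  let ?f = "\<lambda>p x. \<Sum>e\<in>B. p e * x * e"
  obtain g where "Vector_Spaces.linear scale scale g" "?f g = T"
  proof (rule inj_linear_on_End[OF _ _ _ T, of ?f])
    show "Vector_Spaces.linear (fun_scale scale) (fun_scale scale) ?f"
      unfolding Vector_Spaces.linear_iff
      by (simp add: vector_space_fun_scale vector_space_axioms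
          fun_eq_iff fun_scale_def distrib_right sum.distrib scale_sum_right scale_mult_left)
    fix g assume g: "Vector_Spaces.linear scale scale g"
    show "Vector_Spaces.linear scale scale (?f g)"
      unfolding Vector_Spaces.linear_iff
      by (simp add: vector_space_axioms distrib_left distrib_right
          sum.distrib scale_sum_right scale_mult_left scale_mult_right)
    assume "?f g = 0"
    then have g0: "g e = 0" if "e \<in> B" for e
      using sandwich_independent[of g e] that by (simp add: fun_eq_iff)
    show "g = 0"
    proof
      fix x show "g x = 0 x" by (subst linear_expand[OF g]) (simp add: g0)
    qed
  qed
  then show ?thesis by (intro that[of g]) (simp add: fun_eq_iff)
qed

text \<open>
  Comparing the coefficients of \<open>f (y x)\<close> and \<open>f y f x\<close>, written as sums of \<open>p x e\<close>, shows that
  each coefficient \<open>p\<close> of an automorphism \<open>f\<close> satisfies \<open>p y = f y p\<close>; then \<open>A p\<close> is a two-sided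
  ideal, and a nonzero \<open>p\<close> is a unit.
\<close>

theorem Skolem_Noether:
  assumes f: "Vector_Spaces.linear scale scale f" "\<And>x y. f (x * y) = f x * f y" "bij f"
  obtains u v where "u * v = 1" "v * u = 1" "\<And>x. f x = u * x * v"
proof -
  obtain p where p: "\<And>x. f x = (\<Sum>e\<in>B. p e * x * e)"
    using sandwich_exists[OF f(1)] by blast
  have comm: "p e * y = f y * p e" if "e \<in> B" for e y
  proof (rule sandwich_unique[OF _ that])
    fix x
    have "(\<Sum>e\<in>B. p e * y * x * e) = f (y * x)" by (simp add: p mult.assoc)
    also have "\<dots> = f y * (\<Sum>e\<in>B. p e * x * e)" by (simp only: f(2) p[of x])
    finally show "(\<Sum>e\<in>B. p e * y * x * e) = (\<Sum>e\<in>B. f y * p e * x * e)"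
      by (simp add: sum_distrib_left mult.assoc)
  qed
  have "\<exists>e\<in>B. p e \<noteq> 0"
  proof (rule ccontr)
    assume "\<not> (\<exists>e\<in>B. p e \<noteq> 0)"
    then have "f x = 0" for x by (simp add: p)
    then show False using f(3) by (metis bij_pointE zero_neq_one)
  qed
  then obtain e where e: "e \<in> B" "p e \<noteq> 0" by blast
  let ?u = "p e"
  define g where "g = inv_into UNIV f"
  have fi: "f (g y) = y" for y unfolding g_def using f(3) by (simp add: bij_is_surj surj_f_inv_f)
  have J: "two_sided_ideal (range (\<lambda>a. a * ?u))"
    unfolding two_sided_ideal_def
  proof (intro conjI ballI allI)
    show "0 \<in> range (\<lambda>a. a * ?u)" by (rule range_eqI[of _ _ 0]) simp
    fix x assume "x \<in> range (\<lambda>a. a * ?u)"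
    then obtain a where a: "x = a * ?u" by blast
    show "b * x \<in> range (\<lambda>a. a * ?u)" for b
      by (rule range_eqI[of _ _ "b * a"]) (simp add: a mult.assoc)
    show "x * b \<in> range (\<lambda>a. a * ?u)" for b
      by (rule range_eqI[of _ _ "a * f b"]) (simp add: a mult.assoc comm[OF e(1)])
    fix y assume "y \<in> range (\<lambda>a. a * ?u)"
    then obtain b where "y = b * ?u" by blast
    then show "x + y \<in> range (\<lambda>a. a * ?u)"
      by (intro range_eqI[of _ _ "a + b"]) (simp add: a distrib_right)
  qed
  have "1 \<in> range (\<lambda>a. a * ?u)"
    by (rule zero_or_unit_ideal[OF J, of ?u]) (use e(2) in \<open>auto intro: range_eqI[of _ _ 1]\<close>)
  then obtain v where v: "v * ?u = 1" by (metis rangeE)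
  have "?u * g v = 1" using comm[OF e(1), of "g v"] fi v by simp
  then have "v = g v" using v by (metis mult.assoc mult_1_left mult_1_right)
  then have uv: "?u * v = 1" using \<open>?u * g v = 1\<close> by simp
  have "f x = ?u * x * v" for x
    by (simp only: comm[OF e(1), of x] mult.assoc uv mult_1_right)
  then show ?thesis by (rule that[OF uv v])
qed

end


section \<open>Actions of cocommutative Hopf algebras on central simple algebras\<close>

text \<open>
  A basis \<open>C\<close> of \<open>A\<close> that contains \<open>1\<close> and a basis \<open>B\<close> of \<open>H\<close> are fixed.  The comultiplication is \<open>\<Delta> h = (\<Sum>b\<in>B. D b h \<otimes> b)\<close>, and all Sweedler
  sums become sums over \<open>B\<close>.
\<close>

locale cocommutative_action =
  module_algebra sH "UNIV :: 'h set" "(*)" 1 \<Delta> \<epsilon> S sA act +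
  H: finite_basis sH B + A: central_simple_algebra sA C
  for sH :: "'k::field \<Rightarrow> 'h::ring_1 \<Rightarrow> 'h" and \<Delta> \<epsilon> S
    and sA :: "'k \<Rightarrow> 'a::ring_1 \<Rightarrow> 'a" and act B C +
  assumes cocommutative: "cocommutative sH \<Delta>"
begin

abbreviation "bilin \<equiv> bilinear_on sH (UNIV :: 'h set) sH UNIV"
abbreviation "trilin \<equiv> trilinear_on sH (UNIV :: 'h set)"

definition D :: "'h \<Rightarrow> 'h \<Rightarrow> 'h" where
  "D b h = sw (\<lambda>x y. sH (H.coord b y) x) h"

lemma D_bilinear: "bilin sH (\<lambda>x y. sH (H.coord b y) x)"
  by (simp add: bilinear_on_def linear_on_def H.coord_add H.coord_scale scale_right_distrib
      scale_left_distrib mult.commute)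

lemma D_add: "D b (g + h) = D b g + D b h" and D_scale: "D b (sH c h) = sH c (D b h)"
  using linear_on_sw[OF vector_space_axioms D_bilinear] by (simp_all add: D_def linear_on_def)

lemma H_mult_scale: "sH c g * h = sH c (g * h)" "g * sH c h = sH c (g * h)"
  using mul_bilinear by (simp_all add: bilinear_on_def linear_on_def)

lemmas multilinear = trilinear_on_def bilinear_on_def linear_on_def act_linear_simps D_add D_scale
  H_mult_scale scale_right_distrib scale_left_distrib

lemma sw_sum:
  assumes U: "vector_space sU" and f: "bilin sU f"
  shows "sw f h = (\<Sum>b\<in>B. f (D b h) b)"
proof -
  interpret U: vector_space sU by fact
  obtain xs where xs: "\<Delta> h = (\<Sum>(x, y)\<leftarrow>xs. tensor sH UNIV sH UNIV x y)"
    using comul_closed[of h] unfolding tensor_space_def by auto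
  have lift: "tensor_lift sH UNIV sH UNIV g (\<Delta> h) = (\<Sum>(x, y)\<leftarrow>xs. g x y)"
    if "vector_space sW" "bilinear_on sH UNIV sH UNIV sW g" for sW and g :: "'h \<Rightarrow> 'h \<Rightarrow> 'w::ab_group_add"
    unfolding xs by (rule tensor_lift_sum_list[OF that]) simp
  have lin: "linear_on sH UNIV sU (\<lambda>x. f x b)" for b
    using f by (simp add: bilinear_on_def)
  have fl: "Vector_Spaces.linear sH sU (f x)" for x
    using f vector_space_axioms U by (simp add: bilinear_on_def linear_on_def Vector_Spaces.linear_iff)
  have "f (D b h) b = (\<Sum>(x, y)\<leftarrow>xs. sU (H.coord b y) (f x b))" for b
  proof -
    have "f (D b h) b = f (\<Sum>(x, y)\<leftarrow>xs. sH (H.coord b y) x) b"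
      unfolding D_def by (simp only: lift[OF vector_space_axioms D_bilinear])
    also have "\<dots> = (\<Sum>p\<leftarrow>xs. f (case p of (x, y) \<Rightarrow> sH (H.coord b y) x) b)"
      by (rule conjunct2[OF linear_on_sum_list[OF lin vector_space_axioms subspace_V U]]) simp
    also have "\<dots> = (\<Sum>(x, y)\<leftarrow>xs. sU (H.coord b y) (f x b))"
      using lin by (intro arg_cong[where f = sum_list] map_cong refl) (auto simp: linear_on_def)
    finally show ?thesis .
  qed
  then have "(\<Sum>b\<in>B. f (D b h) b) = (\<Sum>b\<in>B. \<Sum>(x, y)\<leftarrow>xs. sU (H.coord b y) (f x b))" by simp
  also have "\<dots> = (\<Sum>(x, y)\<leftarrow>xs. \<Sum>b\<in>B. sU (H.coord b y) (f x b))"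
    by (induction xs) (auto simp: sum.distrib)
  also have "\<dots> = (\<Sum>(x, y)\<leftarrow>xs. f x y)"
    by (intro arg_cong[where f = sum_list] map_cong refl) (auto simp: H.linear_expand[OF fl, symmetric])
  also have "\<dots> = sw f h" by (simp only: lift[OF U f])
  finally show ?thesis by simp
qed

lemma coassoc_sum:
  assumes U: "vector_space sU" and f: "trilin sU f"
  shows "(\<Sum>b\<in>B. \<Sum>c\<in>B. f (D c (D b h)) c b) = (\<Sum>b\<in>B. \<Sum>c\<in>B. f (D b h) (D c b) c)"
proof -
  have "bilin sU (\<lambda>x y. f x y z)" "bilin sU (f x)" for x z
    using f by (auto simp: trilinear_on_def bilinear_on_def)
  then show ?thesis
    using coassoc_trilinear[OF U f, of h] trilinear_sw_left[OF U f] trilinear_sw_right[OF U f]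
    by (simp add: sw_sum[OF U])
qed

lemma cocomm_sum:
  assumes U: "vector_space sU" and f: "bilin sU f"
  shows "(\<Sum>b\<in>B. f (D b h) b) = (\<Sum>b\<in>B. f b (D b h))"
proof -
  let ?t = "tensor sH (UNIV :: 'h set) sH UNIV"
  let ?T = "tensor_space sH (UNIV :: 'h set) sH UNIV"
  let ?s = "fun_scale (*) :: 'k \<Rightarrow> (('h \<Rightarrow> 'h \<Rightarrow> 'k) \<Rightarrow> 'k) \<Rightarrow> (('h \<Rightarrow> 'h \<Rightarrow> 'k) \<Rightarrow> 'k)"
  have f': "bilin sU (\<lambda>x y. f y x)" using f by (simp add: bilinear_on_def)
  have "sw f h = tensor_lift sH UNIV sH UNIV f (sw (\<lambda>x y. ?t y x) h)"
    using cocommutative unfolding cocommutative_def by simp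
  also have "\<dots> = sw (\<lambda>x y. f y x) h"
  proof (rule linear_on_tensor_lift[where sU = ?s and U = ?T])
    show "linear_on ?s ?T sU (tensor_lift sH UNIV sH UNIV f)"
      by (rule tensor_universal_property(1)[OF vector_space_axioms subspace_V U f])
    show "vector_space ?s" by (rule vector_space_fun_scale[OF vector_space_times])
    show "Modules.module.subspace ?s ?T"
      by (rule subspace_tensor_space[OF vector_space_axioms subspace_V])
    show "bilin ?s (\<lambda>x y. ?t y x)"
      using bilinear_tensor[of sH UNIV sH UNIV] by (simp add: bilinear_on_def)
    show "f y x = tensor_lift sH UNIV sH UNIV f (?t y x)" for x y
      by (rule tensor_universal_property(2)[OF vector_space_axioms subspace_V U f, symmetric]) auto
  qed (auto simp: f' U comul_closed tensor_in_tensor_space)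
  finally show ?thesis by (simp add: sw_sum[OF U] f f')
qed

lemma counit_left_sum:
  assumes f: "Vector_Spaces.linear sH sU f"
  shows "(\<Sum>b\<in>B. sU (\<epsilon> (D b h)) (f b)) = f h"
proof -
  interpret f: Vector_Spaces.linear sH sU f by fact
  have "f h = f (sw (\<lambda>x y. sH (\<epsilon> x) y) h)" by (simp add: counit_left)
  also have "sw (\<lambda>x y. sH (\<epsilon> x) y) h = (\<Sum>b\<in>B. sH (\<epsilon> (D b h)) b)"
    by (rule sw_sum[OF vector_space_axioms]) (simp add: multilinear mult.commute)
  finally show ?thesis by (simp add: f.sum f.scale)
qed

lemma counit_right_sum:
  assumes f: "Vector_Spaces.linear sH sU f"
  shows "(\<Sum>b\<in>B. sU (\<epsilon> b) (f (D b h))) = f h"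
proof -
  interpret f: Vector_Spaces.linear sH sU f by fact
  have "f h = f (sw (\<lambda>x y. sH (\<epsilon> y) x) h)" by (simp add: counit_right)
  also have "sw (\<lambda>x y. sH (\<epsilon> y) x) h = (\<Sum>b\<in>B. sH (\<epsilon> b) (D b h))"
    by (rule sw_sum[OF vector_space_axioms]) (simp add: multilinear mult.commute)
  finally show ?thesis by (simp add: f.sum f.scale)
qed

lemma antipode_left_sum: "(\<Sum>b\<in>B. S (D b h) * b) = sH (\<epsilon> h) 1"
  using antipode_left[of h]
  by (simp add: sw_sum[OF vector_space_axioms] multilinear)

lemma antipode_right_sum: "(\<Sum>b\<in>B. D b h * S b) = sH (\<epsilon> h) 1"
  using antipode_right[of h]
  by (simp add: sw_sum[OF vector_space_axioms] multilinear)

lemma act_mult: "act h (a * c) = (\<Sum>b\<in>B. act (D b h) a * act b c)"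
  by (simp add: act_prod sw_sum[OF alg.vector_space_axioms] multilinear)

lemma act_comp: "act g (act h a) = act (g * h) a"
  by (simp add: act_mul)

lemma act_sum_left: "act (\<Sum>i\<in>I. f i) a = (\<Sum>i\<in>I. act (f i) a)"
proof -
  have "act 0 a = 0" using act_scale_left[of 0 0 a] by simp
  then show ?thesis by (induction I rule: infinite_finite_induct) (auto simp: act_add_left)
qed

lemma linear_act: "Vector_Spaces.linear sA sA (act h)"
  by (rule act_linear_on) simp

lemma act_sum: "act h (\<Sum>i\<in>I. f i) = (\<Sum>i\<in>I. act h (f i))"
proof -
  interpret l: Vector_Spaces.linear sA sA "act h" by (rule linear_act)
  show ?thesis by (rule l.sum)
qed

lemma linear_act_left: "Vector_Spaces.linear sH sA (\<lambda>h. act h a)"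
  unfolding Vector_Spaces.linear_iff
  by (simp add: vector_space_axioms alg.vector_space_axioms act_linear_simps)

lemma act_times_sum: "act h a * c = (\<Sum>b\<in>B. act (D b h) (a * act (S b) c))"
  by (simp add: act_times sw_sum[OF alg.vector_space_axioms] multilinear)

text \<open>
  The mirror image of \<open>act_times_sum\<close>: in \<open>(h' (S h''' a)) (h'' c)\<close> cocommutativity brings \<open>h'\<close> and
  \<open>S h'''\<close> together.
\<close>

lemma times_act_sum: "a * act h c = (\<Sum>b\<in>B. act (D b h) (act (S b) a * c))"
proof -
  note vA = alg.vector_space_axioms
  have "(\<Sum>b\<in>B. act (D b h) (act (S b) a * c))
      = (\<Sum>b\<in>B. \<Sum>d\<in>B. act (D d (D b h)) (act (S b) a) * act d c)"
    by (simp add: act_mult)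
  also have "\<dots> = (\<Sum>b\<in>B. \<Sum>d\<in>B. act d (act (S b) a) * act (D d (D b h)) c)"
    by (intro sum.cong refl cocomm_sum[OF vA]) (simp add: multilinear)
  also have "\<dots> = (\<Sum>b\<in>B. \<Sum>d\<in>B. act (D d b) (act (S d) a) * act (D b h) c)"
    by (rule coassoc_sum[OF vA, where f = "\<lambda>x y z. act y (act (S z) a) * act x c"])
      (simp add: multilinear)
  also have "\<dots> = (\<Sum>b\<in>B. act (\<Sum>d\<in>B. D d b * S d) a * act (D b h) c)"
    by (simp add: act_comp act_sum_left sum_distrib_right)
  also have "\<dots> = (\<Sum>b\<in>B. sA (\<epsilon> b) (a * act (D b h) c))"
    by (simp add: antipode_right_sum act_scale_left act_e alg_scale_mult)
  also have "\<dots> = a * act h c"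
    by (rule counit_right_sum[of sA "\<lambda>x. a * act x c"])
      (simp add: Vector_Spaces.linear_iff vector_space_axioms vA act_linear_simps)
  finally show ?thesis by simp
qed

text \<open>
  The antipode of a cocommutative Hopf algebra is a morphism of coalgebras.  What this means for
  products in \<open>A\<close> follows directly from the two preceding formulas.
\<close>

lemma times_act_antipode: "a * act (S h) c = (\<Sum>b\<in>B. act (S (D b h)) (act b a * c))"
proof -
  note vA = alg.vector_space_axioms
  have "(\<Sum>b\<in>B. act (S (D b h)) (act b a * c))
      = (\<Sum>b\<in>B. \<Sum>d\<in>B. act (S (D b h)) (act (D d b) (a * act (S d) c)))"
    by (simp add: act_times_sum[of _ a c] act_sum)
  also have "\<dots> = (\<Sum>b\<in>B. \<Sum>d\<in>B. act (S (D d (D b h))) (act d (a * act (S b) c)))"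
    by (rule coassoc_sum[OF vA, where f = "\<lambda>x y z. act (S x) (act y (a * act (S z) c))", symmetric])
      (simp add: multilinear)
  also have "\<dots> = (\<Sum>b\<in>B. act (\<Sum>d\<in>B. S (D d (D b h)) * d) (a * act (S b) c))"
    by (simp add: act_comp act_sum_left)
  also have "\<dots> = (\<Sum>b\<in>B. sA (\<epsilon> (D b h)) (a * act (S b) c))"
    by (simp add: antipode_left_sum act_scale_left act_e)
  also have "\<dots> = a * act (S h) c"
    by (rule counit_left_sum[of sA "\<lambda>x. a * act (S x) c"])
      (simp add: Vector_Spaces.linear_iff vector_space_axioms vA act_linear_simps)
  finally show ?thesis by simp
qed

lemma act_antipode_mult: "act (S h) (a * c) = (\<Sum>b\<in>B. act (S (D b h)) a * act (S b) c)"
proof -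
  note vA = alg.vector_space_axioms
  have "(\<Sum>b\<in>B. act (S (D b h)) a * act (S b) c) = (\<Sum>b\<in>B. act (S b) a * act (S (D b h)) c)"
    by (rule cocomm_sum[OF vA]) (simp add: multilinear)
  also have "\<dots> = (\<Sum>b\<in>B. \<Sum>d\<in>B. act (S (D d (D b h))) (act d (act (S b) a) * c))"
    by (simp add: times_act_antipode[of "act (S b) a" for b])
  also have "\<dots> = (\<Sum>b\<in>B. \<Sum>d\<in>B. act (S (D b h)) (act (D d b) (act (S d) a) * c))"
    by (rule coassoc_sum[OF vA, where f = "\<lambda>x y z. act (S x) (act y (act (S z) a) * c)"])
      (simp add: multilinear)
  also have "\<dots> = (\<Sum>b\<in>B. act (S (D b h)) (act (\<Sum>d\<in>B. D d b * S d) a * c))"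
    by (simp add: act_comp act_sum_left sum_distrib_right act_sum)
  also have "\<dots> = (\<Sum>b\<in>B. sA (\<epsilon> b) (act (S (D b h)) (a * c)))"
    by (simp add: antipode_right_sum act_scale_left act_e alg_scale_mult act_scale)
  also have "\<dots> = act (S h) (a * c)"
    by (rule counit_right_sum[of sA "\<lambda>x. act (S x) (a * c)"])
      (simp add: Vector_Spaces.linear_iff vector_space_axioms vA act_linear_simps)
  finally show ?thesis by simp
qed

end


section \<open>Invariance of the trace\<close>

text \<open>
  Linear maps from \<open>H\<close> to \<open>A\<close> form an algebra under convolution, and because \<open>H\<close> is
  cocommutative the functionals on \<open>H\<close> form a commutative subalgebra of its centre.  The action
  amounts to the automorphism that sends \<open>a\<close> to the map \<open>h \<mapsto> h a\<close>.
\<close>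

context cocommutative_action
begin

definition conv :: "('h \<Rightarrow> 'k) \<Rightarrow> ('h \<Rightarrow> 'k) \<Rightarrow> 'h \<Rightarrow> 'k" where
  "conv f g h = (\<Sum>b\<in>B. f (D b h) * g b)"

abbreviation "functional \<equiv> Vector_Spaces.linear sH ((*) :: 'k \<Rightarrow> 'k \<Rightarrow> 'k)"

lemma functional_iff: "functional f \<longleftrightarrow> (\<forall>x y. f (x + y) = f x + f y) \<and> (\<forall>c x. f (sH c x) = c * f x)"
  by (simp add: Vector_Spaces.linear_iff vector_space_axioms vector_space_times)

lemma functional_conv:
  assumes "functional f"
  shows "functional (conv f g)"
  using assms by (simp add: functional_iff conv_def D_add D_scale distrib_right sum.distrib
      sum_distrib_left mult.assoc)

lemma conv_assoc:
  assumes "functional f" "functional g" "functional k"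
  shows "conv (conv f g) k = conv f (conv g k)"
proof
  fix h
  have "conv (conv f g) k h = (\<Sum>b\<in>B. \<Sum>c\<in>B. f (D c (D b h)) * g c * k b)"
    by (simp add: conv_def sum_distrib_right)
  also have "\<dots> = (\<Sum>b\<in>B. \<Sum>c\<in>B. f (D b h) * g (D c b) * k c)"
    by (rule coassoc_sum[OF vector_space_times, where f = "\<lambda>x y z. f x * g y * k z"])
      (use assms in \<open>simp add: functional_iff multilinear\<close>)
  also have "\<dots> = conv f (conv g k) h"
    by (simp add: conv_def sum_distrib_left mult.assoc)
  finally show "conv (conv f g) k h = conv f (conv g k) h" .
qed

lemma conv_commute:
  assumes "functional f" "functional g"
  shows "conv f g = conv g f"
proof
  fix h
  have "conv f g h = (\<Sum>b\<in>B. f b * g (D b h))"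
    unfolding conv_def
    by (rule cocomm_sum[OF vector_space_times, where f = "\<lambda>x y. f x * g y"])
      (use assms in \<open>simp add: functional_iff multilinear\<close>)
  then show "conv f g h = conv g f h" by (simp add: conv_def mult.commute)
qed

lemma functional_counit: "functional \<epsilon>"
  by (simp add: functional_iff counit_add counit_scale)

lemma conv_counit:
  assumes "functional f"
  shows "conv f \<epsilon> = f"
  using counit_right_sum[OF assms] by (simp add: conv_def mult.commute fun_eq_iff)

lemma conv_sum: "conv (\<lambda>h. \<Sum>i\<in>I. f i h) g h = (\<Sum>i\<in>I. conv (f i) g h)"
proof -
  have "conv (\<lambda>h. \<Sum>i\<in>I. f i h) g h = (\<Sum>b\<in>B. \<Sum>i\<in>I. f i (D b h) * g b)"
    by (simp add: conv_def sum_distrib_right)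
  also have "\<dots> = (\<Sum>i\<in>I. conv (f i) g h)"
    unfolding conv_def by (rule sum.swap)
  finally show ?thesis .
qed

text \<open>
  In a commutative ring, if \<open>e\<close> annihilates the squares of the \<open>r\<^sub>i\<close> and \<open>e = (\<Sum>i. e r\<^sub>i)\<close>, then
  \<open>e = 0\<close>, because \<open>e = e (\<Sum>i. r\<^sub>i)\<^sup>n\<close> and every monomial of large degree contains a square.  The
  induction applies this first to \<open>e r\<^sub>j\<close>, which is annihilated by \<open>r\<^sub>j\<close>, and then to \<open>e\<close>.
\<close>

lemma comaximal_squares:
  assumes "finite I" "\<And>i. i \<in> I \<Longrightarrow> functional (r i)" "functional e"
    and "\<And>i. i \<in> I \<Longrightarrow> conv (conv e (r i)) (r i) = (\<lambda>_. 0)"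
    and "\<And>h. (\<Sum>i\<in>I. conv e (r i) h) = e h"
  shows "e h = 0"
  using assms
proof (induction I arbitrary: e h rule: finite_induct)
  case (insert j I)
  note r = insert.prems(1) and e = insert.prems(2)
  note IH = insert.IH[of _ _, OF r[OF insertI2]]
  have z: "conv (\<lambda>_. 0) f = (\<lambda>_. 0)" for f by (simp add: conv_def fun_eq_iff)
  have sw: "conv (conv f (r i)) (r i') = conv (conv f (r i')) (r i)"
    if "functional f" "i \<in> insert j I" "i' \<in> insert j I" for f i i'
    using that r by (simp add: conv_assoc conv_commute[of "r i" "r i'"])
  have ej: "conv e (r j) h = 0" for h
  proof (rule IH)
    show "functional (conv e (r j))" by (rule functional_conv[OF e])
    show "conv (conv (conv e (r j)) (r i)) (r i) = (\<lambda>_. 0)" if "i \<in> I" for i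
      using that insert.prems(3)[of i] by (simp add: sw functional_conv e z)
    fix h
    have "(\<Sum>i\<in>I. conv (conv e (r j)) (r i) h) = (\<Sum>i\<in>insert j I. conv (conv e (r j)) (r i) h)"
      using insert.prems(3)[of j] insert.hyps by simp
    also have "\<dots> = (\<Sum>i\<in>insert j I. conv (conv e (r i)) (r j) h)"
      by (intro sum.cong refl) (simp only: sw[OF e] insertI1)
    also have "\<dots> = conv e (r j) h"
      unfolding conv_sum[symmetric] using insert.prems(4) by simp
    finally show "(\<Sum>i\<in>I. conv (conv e (r j)) (r i) h) = conv e (r j) h" .
  qed
  show ?case
  proof (rule IH[OF _ e])
    show "conv (conv e (r i)) (r i) = (\<lambda>_. 0)" if "i \<in> I" for i
      using that insert.prems(3) by simp
    show "(\<Sum>i\<in>I. conv e (r i) h) = e h" for h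
      using insert.prems(4)[of h] insert.hyps by (simp add: ej)
  qed
qed simp


text \<open>
  As \<open>A\<close> is central simple, each \<open>h\<close> acts as an element of \<open>A \<otimes> A\<^sup>o\<^sup>p\<close>; \<open>P h e\<close> is its left
  factor at the basis element \<open>e\<close> of the right factor.
\<close>

definition P :: "'h \<Rightarrow> 'a \<Rightarrow> 'a" where
  "P h = (SOME p. \<forall>x. act h x = (\<Sum>e\<in>C. p e * x * e))"

lemma act_eq: "act h x = (\<Sum>e\<in>C. P h e * x * e)"
proof -
  obtain f where "\<And>x. act h x = (\<Sum>e\<in>C. f e * x * e)"
    using A.sandwich_exists[OF linear_act] by blast
  then have "\<exists>f. \<forall>x. act h x = (\<Sum>e\<in>C. f e * x * e)" by blast
  then show ?thesis unfolding P_def by (rule someI2_ex) simp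
qed

lemma P_add: "e \<in> C \<Longrightarrow> P (g + h) e = P g e + P h e"
  by (rule A.sandwich_unique) (simp_all add: act_eq[symmetric] act_add_left distrib_right sum.distrib)

lemma P_scale: "e \<in> C \<Longrightarrow> P (sH c h) e = sA c (P h e)"
  by (rule A.sandwich_unique)
    (simp_all add: act_eq[symmetric] act_scale_left alg_scale_mult alg.scale_sum_right[symmetric])

text \<open>
  The next four formulas come from comparing coefficients in the product rules for \<open>h\<close> and
  \<open>S h\<close>.  The first one says that \<open>P _ e\<close> intertwines \<open>a\<close> with the map \<open>h \<mapsto> h a\<close>: if it were
  invertible for convolution, it would make the action inner.
\<close>

lemma P_mult: assumes e: "e \<in> C" shows "P h e * a = (\<Sum>b\<in>B. act (D b h) a * P b e)"
proof (rule A.sandwich_unique[OF _ e])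
  fix x
  have "(\<Sum>e\<in>C. P h e * a * x * e) = (\<Sum>b\<in>B. act (D b h) a * (\<Sum>e\<in>C. P b e * x * e))"
    by (simp add: act_eq[symmetric] act_mult[symmetric]) (simp add: act_eq mult.assoc)
  also have "\<dots> = (\<Sum>b\<in>B. \<Sum>e\<in>C. act (D b h) a * P b e * x * e)"
    by (simp add: sum_distrib_left mult.assoc)
  also have "\<dots> = (\<Sum>e\<in>C. (\<Sum>b\<in>B. act (D b h) a * P b e) * x * e)"
    by (subst sum.swap) (simp add: sum_distrib_right)
  finally show "(\<Sum>e\<in>C. P h e * a * x * e) = (\<Sum>e\<in>C. (\<Sum>b\<in>B. act (D b h) a * P b e) * x * e)" .
qed

lemma mult_P: assumes e: "e \<in> C" shows "a * P h e = (\<Sum>b\<in>B. P (D b h) e * act (S b) a)"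
proof (rule A.sandwich_unique[OF _ e])
  fix x
  have "(\<Sum>e\<in>C. a * P h e * x * e) = a * act h x"
    by (simp add: act_eq sum_distrib_left mult.assoc)
  also have "\<dots> = (\<Sum>b\<in>B. \<Sum>e\<in>C. P (D b h) e * act (S b) a * x * e)"
    by (subst times_act_sum) (simp add: act_eq[of "D b h" for b] mult.assoc)
  also have "\<dots> = (\<Sum>e\<in>C. (\<Sum>b\<in>B. P (D b h) e * act (S b) a) * x * e)"
    by (subst sum.swap) (simp add: sum_distrib_right)
  finally show "(\<Sum>e\<in>C. a * P h e * x * e) = (\<Sum>e\<in>C. (\<Sum>b\<in>B. P (D b h) e * act (S b) a) * x * e)" .
qed

lemma PS_mult:
  assumes e: "e \<in> C" shows "P (S h) e * a = (\<Sum>b\<in>B. act (S (D b h)) a * P (S b) e)"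
proof (rule A.sandwich_unique[OF _ e])
  fix x
  have "(\<Sum>e\<in>C. P (S h) e * a * x * e) = act (S h) (a * x)"
    by (simp add: act_eq mult.assoc)
  also have "\<dots> = (\<Sum>b\<in>B. \<Sum>e\<in>C. act (S (D b h)) a * P (S b) e * x * e)"
    by (simp add: act_antipode_mult) (simp add: act_eq[of "S b" for b] sum_distrib_left mult.assoc)
  also have "\<dots> = (\<Sum>e\<in>C. (\<Sum>b\<in>B. act (S (D b h)) a * P (S b) e) * x * e)"
    by (subst sum.swap) (simp add: sum_distrib_right)
  finally show "(\<Sum>e\<in>C. P (S h) e * a * x * e)
    = (\<Sum>e\<in>C. (\<Sum>b\<in>B. act (S (D b h)) a * P (S b) e) * x * e)" .
qed

lemma mult_PS:
  assumes e: "e \<in> C" shows "a * P (S h) e = (\<Sum>b\<in>B. P (S (D b h)) e * act b a)"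
proof (rule A.sandwich_unique[OF _ e])
  fix x
  have "(\<Sum>e\<in>C. a * P (S h) e * x * e) = a * act (S h) x"
    by (simp add: act_eq sum_distrib_left mult.assoc)
  also have "\<dots> = (\<Sum>b\<in>B. \<Sum>e\<in>C. P (S (D b h)) e * act b a * x * e)"
    by (subst times_act_antipode) (simp add: act_eq[of "S (D b h)" for b] mult.assoc)
  also have "\<dots> = (\<Sum>e\<in>C. (\<Sum>b\<in>B. P (S (D b h)) e * act b a) * x * e)"
    by (subst sum.swap) (simp add: sum_distrib_right)
  finally show "(\<Sum>e\<in>C. a * P (S h) e * x * e)
    = (\<Sum>e\<in>C. (\<Sum>b\<in>B. P (S (D b h)) e * act b a) * x * e)" .
qed

text \<open>
  Maps that intertwine in the opposite direction.  Contracting the right factors with the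
  functional \<open>coord 1\<close> is what makes the sum of the products \<open>P e * Q e\<close> equal to \<open>\<epsilon>\<close> in
  \<open>sum_rho\<close>.
\<close>

definition Q :: "'a \<Rightarrow> 'h \<Rightarrow> 'a" where
  "Q e h = (\<Sum>f\<in>C. sA (A.coord 1 (f * e)) (P (S h) f))"

lemma Q_add: "Q e (g + h) = Q e g + Q e h"
  by (simp add: Q_def antipode_add P_add alg.scale_right_distrib sum.distrib)

lemma Q_scale: "Q e (sH c h) = sA c (Q e h)"
  by (simp add: Q_def antipode_scale P_scale alg.scale_sum_right mult.commute)

lemma Q_mult: "Q e h * a = (\<Sum>b\<in>B. act (S (D b h)) a * Q e b)"
proof -
  have "Q e h * a = (\<Sum>f\<in>C. \<Sum>b\<in>B. sA (A.coord 1 (f * e)) (act (S (D b h)) a * P (S b) f))"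
    by (simp add: Q_def sum_distrib_right alg_scale_mult PS_mult alg.scale_sum_right)
  also have "\<dots> = (\<Sum>b\<in>B. act (S (D b h)) a * Q e b)"
    by (subst sum.swap) (simp add: Q_def sum_distrib_left alg_scale_mult)
  finally show ?thesis .
qed

lemma mult_Q: "a * Q e h = (\<Sum>b\<in>B. Q e (D b h) * act b a)"
proof -
  have "a * Q e h = (\<Sum>f\<in>C. \<Sum>b\<in>B. sA (A.coord 1 (f * e)) (P (S (D b h)) f * act b a))"
    by (simp add: Q_def sum_distrib_left alg_scale_mult mult_PS alg.scale_sum_right)
  also have "\<dots> = (\<Sum>b\<in>B. Q e (D b h) * act b a)"
    by (subst sum.swap) (simp add: Q_def sum_distrib_right alg_scale_mult)
  finally show ?thesis .
qed

lemmas multilinear_coeffs = multilinear P_add P_scale Q_add Q_scale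

text \<open>
  The two convolution products of \<open>P _ e\<close> and \<open>Q e\<close>.  Moving \<open>a\<close> past both factors applies
  mutually inverse transformations to it, so that their values are central, hence scalars.
\<close>

definition R :: "'a \<Rightarrow> 'h \<Rightarrow> 'a" where
  "R e h = (\<Sum>b\<in>B. P (D b h) e * Q e b)"

definition Z :: "'a \<Rightarrow> 'h \<Rightarrow> 'a" where
  "Z e h = (\<Sum>b\<in>B. Q e (D b h) * P b e)"

lemma R_central: assumes e: "e \<in> C" shows "R e h * a = a * R e h"
proof -
  note vA = alg.vector_space_axioms
  have "a * R e h = (\<Sum>b\<in>B. \<Sum>c\<in>B. P (D c (D b h)) e * act (S c) a * Q e b)"
    by (simp add: R_def sum_distrib_left mult.assoc[symmetric] mult_P[OF e] sum_distrib_right)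
  also have "\<dots> = (\<Sum>b\<in>B. \<Sum>c\<in>B. P (D b h) e * act (S (D c b)) a * Q e c)"
    by (rule coassoc_sum[OF vA, where f = "\<lambda>u v w. P u e * act (S v) a * Q e w"])
      (simp add: multilinear_coeffs e)
  also have "\<dots> = R e h * a"
    by (simp add: R_def sum_distrib_right sum_distrib_left mult.assoc Q_mult)
  finally show ?thesis by simp
qed

lemma Z_central: assumes e: "e \<in> C" shows "Z e h * a = a * Z e h"
proof -
  note vA = alg.vector_space_axioms
  have "a * Z e h = (\<Sum>b\<in>B. \<Sum>c\<in>B. Q e (D c (D b h)) * act c a * P b e)"
    by (simp add: Z_def sum_distrib_left mult.assoc[symmetric] mult_Q sum_distrib_right)
  also have "\<dots> = (\<Sum>b\<in>B. \<Sum>c\<in>B. Q e (D b h) * act (D c b) a * P c e)"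
    by (rule coassoc_sum[OF vA, where f = "\<lambda>u v w. Q e u * act v a * P w e"])
      (simp add: multilinear_coeffs e)
  also have "\<dots> = Z e h * a"
    by (simp add: Z_def sum_distrib_right sum_distrib_left mult.assoc P_mult[OF e])
  finally show ?thesis by simp
qed

definition \<rho> :: "'a \<Rightarrow> 'h \<Rightarrow> 'k" where "\<rho> e h = A.coord 1 (R e h)"
definition \<zeta> :: "'a \<Rightarrow> 'h \<Rightarrow> 'k" where "\<zeta> e h = A.coord 1 (Z e h)"

lemma R_eq: "e \<in> C \<Longrightarrow> R e h = sA (\<rho> e h) 1"
  unfolding \<rho>_def by (rule A.scalar_coord[symmetric]) (rule R_central)

lemma Z_eq: "e \<in> C \<Longrightarrow> Z e h = sA (\<zeta> e h) 1"
  unfolding \<zeta>_def by (rule A.scalar_coord[symmetric]) (rule Z_central)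

lemma functional_rho: "e \<in> C \<Longrightarrow> functional (\<rho> e)"
  by (simp add: functional_iff \<rho>_def R_def multilinear_coeffs sum.distrib A.coord_add
      alg.scale_sum_right[symmetric] A.coord_scale)

lemma functional_zeta: "e \<in> C \<Longrightarrow> functional (\<zeta> e)"
  by (simp add: functional_iff \<zeta>_def Z_def multilinear_coeffs sum.distrib A.coord_add
      alg.scale_sum_right[symmetric] A.coord_scale)

text \<open>
  With \<open>*\<close> for convolution, \<open>(P * Q) * (P * Q) = P * (Q * P) * Q = (Q * P) * (P * Q)\<close>, because
  \<open>Q * P\<close> is scalar valued and therefore central.
\<close>

lemma R_square:
  assumes e: "e \<in> C"
  shows "conv (\<rho> e) (\<rho> e) = conv (\<zeta> e) (\<rho> e)"
proof
  note vA = alg.vector_space_axioms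
  note \<rho> = functional_rho[OF e, unfolded functional_iff]
  fix h
  have "sA (conv (\<rho> e) (\<rho> e) h) 1 = (\<Sum>b\<in>B. R e (D b h) * R e b)"
    by (simp add: conv_def alg.scale_sum_left R_eq[OF e] alg_scale_mult mult.commute)
  also have "\<dots> = (\<Sum>b\<in>B. \<Sum>c\<in>B. P (D c (D b h)) e * Q e c * R e b)"
    by (simp add: R_def[of e "D b h" for b] sum_distrib_right)
  also have "\<dots> = (\<Sum>b\<in>B. \<Sum>c\<in>B. P (D b h) e * Q e (D c b) * R e c)"
    by (rule coassoc_sum[OF vA, where f = "\<lambda>u v w. P u e * Q e v * R e w"])
      (use \<rho> in \<open>simp add: multilinear_coeffs e R_eq[OF e]\<close>)
  also have "\<dots> = (\<Sum>b\<in>B. P (D b h) e * (\<Sum>c\<in>B. Q e (D c b) * R e c))"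
    by (simp add: sum_distrib_left mult.assoc)
  also have "\<dots> = (\<Sum>b\<in>B. P (D b h) e * (\<Sum>c\<in>B. Z e (D c b) * Q e c))"
  proof -
    have "(\<Sum>c\<in>B. Q e (D c h) * R e c) = (\<Sum>c\<in>B. Z e (D c h) * Q e c)" for h
    proof -
      have "(\<Sum>c\<in>B. Q e (D c h) * R e c) = (\<Sum>b\<in>B. \<Sum>c\<in>B. Q e (D b h) * P (D c b) e * Q e c)"
        by (simp add: R_def sum_distrib_left mult.assoc)
      also have "\<dots> = (\<Sum>b\<in>B. \<Sum>c\<in>B. Q e (D c (D b h)) * P c e * Q e b)"
        by (rule coassoc_sum[OF vA, where f = "\<lambda>u v w. Q e u * P v e * Q e w", symmetric])
          (simp add: multilinear_coeffs e)
      also have "\<dots> = (\<Sum>c\<in>B. Z e (D c h) * Q e c)"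
        by (simp add: Z_def sum_distrib_right)
      finally show ?thesis .
    qed
    then show ?thesis by simp
  qed
  also have "\<dots> = (\<Sum>b\<in>B. \<Sum>c\<in>B. sA (\<zeta> e (D c b)) (P (D b h) e * Q e c))"
    by (simp add: Z_eq[OF e] sum_distrib_left alg_scale_mult)
  also have "\<dots> = (\<Sum>b\<in>B. \<Sum>c\<in>B. sA (\<zeta> e c) (P (D c (D b h)) e * Q e b))"
    by (rule coassoc_sum[OF vA, where f = "\<lambda>u v w. sA (\<zeta> e v) (P u e * Q e w)", symmetric])
      (use functional_zeta[OF e, unfolded functional_iff] in \<open>simp add: multilinear_coeffs e mult.commute\<close>)
  also have "\<dots> = (\<Sum>b\<in>B. \<Sum>c\<in>B. sA (\<zeta> e (D c (D b h))) (P c e * Q e b))"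
    by (intro sum.cong refl cocomm_sum[OF vA, symmetric])
      (use functional_zeta[OF e, unfolded functional_iff] in \<open>simp add: multilinear_coeffs e mult.commute\<close>)
  also have "\<dots> = (\<Sum>b\<in>B. \<Sum>c\<in>B. sA (\<zeta> e (D b h)) (P (D c b) e * Q e c))"
    by (rule coassoc_sum[OF vA, where f = "\<lambda>u v w. sA (\<zeta> e u) (P v e * Q e w)"])
      (use functional_zeta[OF e, unfolded functional_iff] in \<open>simp add: multilinear_coeffs e mult.commute\<close>)
  also have "\<dots> = (\<Sum>b\<in>B. sA (\<zeta> e (D b h)) (R e b))"
    by (simp add: R_def alg.scale_sum_right)
  also have "\<dots> = sA (conv (\<zeta> e) (\<rho> e) h) 1"
    by (simp add: conv_def alg.scale_sum_left R_eq[OF e])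
  finally show "conv (\<rho> e) (\<rho> e) h = conv (\<zeta> e) (\<rho> e) h"
    by (metis A.coord_scalar)
qed

text \<open>
  This is the relation \<open>h' (S h'' x) = \<epsilon> h x\<close>, of which the coefficient at the basis element
  \<open>1\<close> is taken.
\<close>

lemma sum_rho: "(\<Sum>e\<in>C. \<rho> e h) = \<epsilon> h"
proof -
  define w where "w f = (\<Sum>e\<in>C. \<Sum>e'\<in>C. sA (A.coord f (e' * e)) (\<Sum>b\<in>B. P (D b h) e * P (S b) e'))" for f
  have "w f = sA (\<epsilon> h * A.coord f 1) 1" if f: "f \<in> C" for f
  proof (rule A.sandwich_unique[OF _ f])
    fix x
    have "(\<Sum>f\<in>C. w f * x * f)
        = (\<Sum>e\<in>C. \<Sum>e'\<in>C. \<Sum>b\<in>B. \<Sum>f\<in>C. sA (A.coord f (e' * e)) (P (D b h) e * P (S b) e' * x * f))"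
    proof -
      have "(\<Sum>f\<in>C. w f * x * f)
        = (\<Sum>f\<in>C. \<Sum>e\<in>C. \<Sum>e'\<in>C. \<Sum>b\<in>B. sA (A.coord f (e' * e)) (P (D b h) e * P (S b) e' * x * f))"
        by (simp add: w_def sum_distrib_right alg.scale_sum_right alg_scale_mult)
      also have "\<dots> = (\<Sum>e\<in>C. \<Sum>f\<in>C. \<Sum>e'\<in>C. \<Sum>b\<in>B. sA (A.coord f (e' * e)) (P (D b h) e * P (S b) e' * x * f))"
        by (rule sum.swap)
      also have "\<dots> = (\<Sum>e\<in>C. \<Sum>e'\<in>C. \<Sum>f\<in>C. \<Sum>b\<in>B. sA (A.coord f (e' * e)) (P (D b h) e * P (S b) e' * x * f))"
        by (intro sum.cong refl sum.swap)
      also have "\<dots> = (\<Sum>e\<in>C. \<Sum>e'\<in>C. \<Sum>b\<in>B. \<Sum>f\<in>C. sA (A.coord f (e' * e)) (P (D b h) e * P (S b) e' * x * f))"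
        by (intro sum.cong refl sum.swap)
      finally show ?thesis .
    qed
    also have "\<dots> = (\<Sum>e\<in>C. \<Sum>e'\<in>C. \<Sum>b\<in>B. P (D b h) e * P (S b) e' * x * (e' * e))"
    proof (intro sum.cong refl)
      fix e e' b
      show "(\<Sum>f\<in>C. sA (A.coord f (e' * e)) (P (D b h) e * P (S b) e' * x * f))
          = P (D b h) e * P (S b) e' * x * (e' * e)"
        by (subst (2) A.sum_coord[symmetric]) (simp only: sum_distrib_left alg_scale_mult)
    qed
    also have "\<dots> = (\<Sum>b\<in>B. \<Sum>e\<in>C. \<Sum>e'\<in>C. P (D b h) e * P (S b) e' * x * (e' * e))"
      by (subst (2) sum.swap) (simp add: sum.swap[of _ B C])
    also have "\<dots> = (\<Sum>b\<in>B. act (D b h) (act (S b) x))"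
      by (simp add: act_eq sum_distrib_left sum_distrib_right mult.assoc)
    also have "\<dots> = sA (\<epsilon> h) x"
      by (simp add: act_comp act_sum_left[symmetric] antipode_right_sum act_scale_left act_e)
    also have "\<dots> = sA (\<epsilon> h) (x * (\<Sum>f\<in>C. sA (A.coord f 1) f))"
      by (simp add: A.sum_coord)
    also have "\<dots> = (\<Sum>f\<in>C. sA (\<epsilon> h * A.coord f 1) 1 * x * f)"
      by (simp only: sum_distrib_left alg_scale_mult alg.scale_sum_right alg.scale_scale mult_1_left)
    finally show "(\<Sum>f\<in>C. w f * x * f) = (\<Sum>f\<in>C. sA (\<epsilon> h * A.coord f 1) 1 * x * f)" .
  qed
  from this[OF A.one_B] have "A.coord 1 (w 1) = \<epsilon> h"
    by (simp add: A.coord_scalar A.coord_one)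
  moreover have "w 1 = (\<Sum>e\<in>C. R e h)"
  proof -
    have "w 1 = (\<Sum>e\<in>C. \<Sum>e'\<in>C. \<Sum>b\<in>B. sA (A.coord 1 (e' * e)) (P (D b h) e * P (S b) e'))"
      by (simp add: w_def alg.scale_sum_right)
    also have "\<dots> = (\<Sum>e\<in>C. \<Sum>b\<in>B. \<Sum>e'\<in>C. sA (A.coord 1 (e' * e)) (P (D b h) e * P (S b) e'))"
      by (intro sum.cong refl sum.swap)
    also have "\<dots> = (\<Sum>e\<in>C. R e h)"
      by (simp add: R_def Q_def sum_distrib_left alg_scale_mult)
    finally show ?thesis .
  qed
  ultimately show ?thesis by (simp add: \<rho>_def A.coord_sum)
qed

text \<open>
  The trace of \<open>P h' * a * Q h''\<close> can be computed by moving \<open>P\<close> to the right of \<open>a\<close>, which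
  replaces \<open>a\<close> by its image under the action, or by moving \<open>P\<close> cyclically to the end.  Hence
  \<open>\<zeta> = \<beta> * \<rho>\<close>.  With \<open>\<rho> * \<rho> = \<zeta> * \<rho>\<close> this shows that \<open>\<epsilon> - \<beta>\<close> annihilates \<open>\<rho> * \<rho>\<close>.
\<close>

theorem trace_invariant:
  assumes tr: "Vector_Spaces.linear sA (*) tr" "\<And>a b. tr (a * b) = tr (b * a)" "tr a0 \<noteq> 0"
    and \<beta>: "functional \<beta>" "\<And>h a. tr (act h a) = \<beta> h * tr a"
  shows "\<beta> = \<epsilon>"
proof -
  interpret tr: Vector_Spaces.linear sA "(*)" tr by fact
  have trk: "tr (a * R e h) = \<rho> e h * tr a" "tr (a * Z e h) = \<zeta> e h * tr a" if "e \<in> C" for a e h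
    using that by (simp_all add: R_eq Z_eq alg_scale_mult tr.scale)
  have s: "\<zeta> e = conv \<beta> (\<rho> e)" if e: "e \<in> C" for e
  proof
    fix h
    have "(\<Sum>b\<in>B. tr (P (D b h) e * a0 * Q e b)) = (\<Sum>b\<in>B. \<Sum>c\<in>B. tr (act (D c (D b h)) a0 * P c e * Q e b))"
      by (simp add: P_mult[OF e] sum_distrib_right tr.sum)
    also have "\<dots> = (\<Sum>b\<in>B. \<Sum>c\<in>B. tr (act (D b h) a0 * P (D c b) e * Q e c))"
      by (rule coassoc_sum[OF vector_space_times, where f = "\<lambda>u v w. tr (act u a0 * P v e * Q e w)"])
        (simp add: multilinear_coeffs e tr.add tr.scale)
    also have "\<dots> = (\<Sum>b\<in>B. tr (act (D b h) a0 * R e b))"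
      by (simp add: R_def sum_distrib_left mult.assoc tr.sum)
    also have "\<dots> = conv \<beta> (\<rho> e) h * tr a0"
      unfolding conv_def sum_distrib_right
      by (intro sum.cong refl) (simp add: trk e \<beta>(2))
    finally have 1: "(\<Sum>b\<in>B. tr (P (D b h) e * a0 * Q e b)) = conv \<beta> (\<rho> e) h * tr a0" .
    have "(\<Sum>b\<in>B. tr (P (D b h) e * a0 * Q e b)) = (\<Sum>b\<in>B. tr (a0 * (Q e b * P (D b h) e)))"
      by (intro sum.cong refl) (metis tr(2) mult.assoc)
    also have "\<dots> = (\<Sum>b\<in>B. tr (a0 * (Q e (D b h) * P b e)))"
      by (rule cocomm_sum[OF vector_space_times, where f = "\<lambda>u v. tr (a0 * (Q e u * P v e))", symmetric])
        (simp add: multilinear_coeffs e tr.add tr.scale)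
    also have "\<dots> = \<zeta> e h * tr a0"
      unfolding trk(2)[OF e, symmetric] by (simp add: Z_def sum_distrib_left tr.sum)
    finally show "\<zeta> e h = conv \<beta> (\<rho> e) h" using 1 tr(3) by simp
  qed
  define e where "e h = \<epsilon> h - \<beta> h" for h
  have conv_e: "conv e f h = conv \<epsilon> f h - conv \<beta> f h" for f h
    by (simp add: conv_def e_def left_diff_distrib sum_subtractf)
  have conv_\<epsilon>: "conv \<epsilon> f = f" if "functional f" for f
    using conv_commute[OF functional_counit that] conv_counit[OF that] by simp
  have e: "functional e"
    using \<beta>(1) functional_counit by (simp add: functional_iff e_def algebra_simps)
  have "e h = 0" for h
  proof (rule comaximal_squares[OF A.finite_B functional_rho e])
    fix x assume x: "x \<in> C"
    note rx = functional_rho[OF x]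
    have "conv (conv e (\<rho> x)) (\<rho> x) h = 0" for h
    proof -
      have "conv (conv e (\<rho> x)) (\<rho> x) h = conv e (conv (\<rho> x) (\<rho> x)) h"
        by (simp only: conv_assoc[OF e rx rx])
      also have "\<dots> = conv (\<rho> x) (\<rho> x) h - conv (conv \<beta> (\<rho> x)) (\<rho> x) h"
        by (simp add: conv_e conv_\<epsilon> functional_conv rx conv_assoc[OF \<beta>(1) rx rx])
      also have "\<dots> = 0"
        by (simp only: R_square[OF x] s[OF x] diff_self)
      finally show ?thesis .
    qed
    then show "conv (conv e (\<rho> x)) (\<rho> x) = (\<lambda>_. 0)" by blast
  next
    fix h
    have "(\<Sum>x\<in>C. conv e (\<rho> x) h) = (\<Sum>x\<in>C. conv (\<rho> x) e h)"
      by (intro sum.cong refl fun_cong[OF conv_commute[OF e functional_rho]])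
    also have "\<dots> = conv \<epsilon> e h"
      unfolding conv_sum[symmetric] sum_rho ..
    finally show "(\<Sum>x\<in>C. conv e (\<rho> x) h) = e h" by (simp add: conv_\<epsilon> e)
  qed
  then show ?thesis by (simp add: e_def fun_eq_iff)
qed

end


section \<open>Galois module algebras\<close>

locale galois_action = cocommutative_action sH \<Delta> \<epsilon> S sA act B C
  for sH :: "'k::field \<Rightarrow> 'h::ring_1 \<Rightarrow> 'h" and \<Delta> \<epsilon> S
    and sA :: "'k \<Rightarrow> 'a::ring_1 \<Rightarrow> 'a" and act B C +
  assumes galois: "dual_galois sH sA act"
begin

lemma galois_bilinear:
  "bilinear_on sA UNIV sH UNIV (fun_scale sA) (\<lambda>a h c. a * act h c)"
  by (simp add: bilinear_on_def linear_on_def fun_scale_def fun_eq_iff act_linear_simps)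

lemma galois_sum_list:
  "tensor_lift sA UNIV sH UNIV (\<lambda>a h c. a * act h c) (\<Sum>(a, h)\<leftarrow>xs. tensor sA UNIV sH UNIV a h)
    = (\<Sum>(a, h)\<leftarrow>xs. (\<lambda>c. a * act h c))"
  by (rule tensor_lift_sum_list[OF vector_space_fun_scale[OF alg.vector_space_axioms] galois_bilinear])
    simp

lemma operator_exists:
  assumes "Vector_Spaces.linear sA sA T"
  obtains f where "\<And>c. T c = (\<Sum>b\<in>B. f b * act b c)"
proof -
  have "T \<in> tensor_lift sA UNIV sH UNIV (\<lambda>a h c. a * act h c) ` tensor_space sA UNIV sH UNIV"
    using galois assms unfolding dual_galois_def bij_betw_def by simp
  then obtain xs where T: "T = (\<Sum>(a, h)\<leftarrow>xs. (\<lambda>c. a * act h c))"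
    unfolding tensor_space_def by (auto simp: galois_sum_list)
  have "T c = (\<Sum>b\<in>B. (\<Sum>(a, h)\<leftarrow>xs. sA (H.coord b h) a) * act b c)" for c
  proof -
    have *: "a * act h c = (\<Sum>b\<in>B. sA (H.coord b h) a * act b c)" for a h
      by (subst H.linear_expand[OF linear_act_left]) (simp add: sum_distrib_left alg_scale_mult)
    have "T c = (\<Sum>(a, h)\<leftarrow>xs. a * act h c)"
      unfolding T by (induction xs) auto
    also have "\<dots> = (\<Sum>(a, h)\<leftarrow>xs. \<Sum>b\<in>B. sA (H.coord b h) a * act b c)"
      by (subst *) (rule refl)
    also have "\<dots> = (\<Sum>b\<in>B. (\<Sum>(a, h)\<leftarrow>xs. sA (H.coord b h) a) * act b c)"
      by (induction xs) (auto simp: sum.distrib distrib_right)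
    finally show ?thesis .
  qed
  then show ?thesis by (rule that)
qed

lemma operator_unique:
  assumes f: "\<And>c. (\<Sum>b\<in>B. f b * act b c) = 0" and b: "b \<in> B"
  shows "f b = 0"
proof -
  let ?L = "tensor_lift sA UNIV sH UNIV (\<lambda>a h c. a * act h c)"
  let ?T = "tensor_space sA (UNIV :: 'a set) sH (UNIV :: 'h set)"
  obtain bs where bs: "set bs = B" "distinct bs" using finite_distinct_list[OF H.finite_B] by blast
  have sum: "(\<Sum>(a, h)\<leftarrow>map (\<lambda>b. (f b, b)) bs. g a h) = (\<Sum>b\<in>B. g (f b) b)"
    for g :: "'a \<Rightarrow> 'h \<Rightarrow> 'x::comm_monoid_add"
    using sum_list_distinct_conv_sum_set[OF bs(2), of "\<lambda>b. g (f b) b"]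
    unfolding bs(1) map_map comp_def prod.case .
  define t where "t = (\<Sum>(a, h)\<leftarrow>map (\<lambda>b. (f b, b)) bs. tensor sA UNIV sH UNIV a h)"
  have t: "t \<in> ?T"
    unfolding tensor_space_def t_def by (intro CollectI exI[of _ "map (\<lambda>b. (f b, b)) bs"]) simp
  have z: "0 \<in> ?T" unfolding tensor_space_def by (intro CollectI exI[of _ "[]"]) simp
  have "?L t = (\<Sum>b\<in>B. (\<lambda>c. f b * act b c))"
    unfolding t_def galois_sum_list by (rule sum)
  also have "\<dots> = 0" by (rule ext) (simp only: sum_fun_apply f zero_fun_apply)
  also have "\<dots> = ?L 0" using galois_sum_list[of "[]"] by simp
  finally have L0: "?L t = ?L 0" .
  have "inj_on ?L ?T" using galois unfolding dual_galois_def bij_betw_def by (rule conjunct1)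
  then have "t = 0" by (rule inj_onD[OF _ L0 t z])
  have "A.coord e (f b) = A.coord e 0" for e
  proof -
    have bil: "bilinear_on sA UNIV sH UNIV (*) (\<lambda>a h. A.coord e a * H.coord b h)"
      by (simp add: bilinear_on_def linear_on_def A.coord_add A.coord_scale H.coord_add H.coord_scale
          distrib_left distrib_right mult.left_commute)
    have "0 = t (\<lambda>a h. A.coord e a * H.coord b h)" unfolding \<open>t = 0\<close> by simp
    also have "\<dots> = (\<Sum>(a, h)\<leftarrow>map (\<lambda>b. (f b, b)) bs. A.coord e a * H.coord b h)"
      unfolding t_def sum_list_tensor_apply by (simp only: bil if_True)
    also have "\<dots> = (\<Sum>c\<in>B. A.coord e (f c) * H.coord b c)" by (rule sum)
    also have "\<dots> = (\<Sum>c\<in>B. if c = b then A.coord e (f c) else 0)"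
      by (intro sum.cong refl) (auto simp: H.coord_basis)
    also have "\<dots> = A.coord e (f b)" using b H.finite_B by simp
    finally show ?thesis by simp
  qed
  then show ?thesis by (rule A.coord_inject)
qed

lemma act_faithful:
  assumes "\<And>c. act g c = act h c"
  shows "g = h"
proof (rule H.coord_inject)
  fix b assume b: "b \<in> B"
  have "sA (H.coord b (g - h)) 1 = 0"
  proof (rule operator_unique[OF _ b])
    fix c
    have "(\<Sum>b\<in>B. sA (H.coord b (g - h)) 1 * act b c) = act (g - h) c"
      by (subst H.linear_expand[OF linear_act_left, of "g - h"]) (simp add: alg_scale_mult)
    also have "\<dots> = 0" using assms act_add_left[of "g - h" h c] by simp
    finally show "(\<Sum>b\<in>B. sA (H.coord b (g - h)) 1 * act b c) = 0" .
  qed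
  then have "H.coord b (g - h) = 0" by simp
  then show "H.coord b g = H.coord b h" using H.coord_add[of b "g - h" h] by simp
qed

text \<open>
  Right multiplication by an invariant element commutes with all operators \<open>c \<mapsto> a (h c)\<close>, hence
  with all linear operators.
\<close>

lemma invariant_scalar:
  assumes a: "\<And>h. act h a = sA (\<epsilon> h) a"
  shows "a = sA (A.coord 1 a) 1"
proof -
  let ?T = "\<lambda>c. sA (A.coord 1 c) 1"
  have "Vector_Spaces.linear sA sA ?T"
    unfolding Vector_Spaces.linear_iff
    by (simp add: alg.vector_space_axioms A.coord_add A.coord_scale alg.scale_left_distrib)
  then obtain f where f: "\<And>c. ?T c = (\<Sum>b\<in>B. f b * act b c)" using operator_exists by blast
  have "act h (c * a) = act h c * a" for h c
  proof -
    have "act h (c * a) = (\<Sum>b\<in>B. sA (\<epsilon> b) (act (D b h) c * a))"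
      by (simp add: act_mult a alg_scale_mult)
    also have "\<dots> = act h c * a"
      by (rule counit_right_sum[of sA "\<lambda>x. act x c * a"])
        (simp add: Vector_Spaces.linear_iff vector_space_axioms alg.vector_space_axioms act_linear_simps)
    finally show ?thesis .
  qed
  then have "?T (1 * a) = ?T 1 * a"
    unfolding f by (simp only: sum_distrib_right mult.assoc)
  then show ?thesis by (simp add: A.coord_one)
qed

text \<open>
  The next lemmas prepare the double centraliser property.  A functional \<open>l\<close> on \<open>H\<close> has unique
  coordinates \<open>\<sigma> l j\<close> with \<open>(\<Sum>j\<in>C. act h (\<sigma> l j) * j) = l h\<close> for all \<open>h\<close>.  They
  are \<open>H\<close>-linear in \<open>l\<close>, so that the dual of the \<open>H\<close>-module \<open>H\<close> becomes a direct summand of a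
  power of \<open>A\<close>.  Uniqueness holds because \<open>h\<close> may be replaced by any linear operator.
\<close>

lemma sigma_unique:
  assumes d: "\<And>h. (\<Sum>j\<in>C. act h (d j) * j) = (\<Sum>j\<in>C. act h (d' j) * j)" and j: "j \<in> C"
  shows "d j = d' j"
proof -
  interpret lact: Vector_Spaces.linear sA sA "act h" for h by (rule linear_act)
  have z: "(\<Sum>j\<in>C. act h (d j - d' j) * j) = 0" for h
    using d by (simp add: lact.diff left_diff_distrib sum_subtractf)
  have "A.coord e (d j - d' j) = A.coord e 0" for e
  proof -
    let ?T = "\<lambda>c. sA (A.coord e c) 1"
    have "Vector_Spaces.linear sA sA ?T"
      unfolding Vector_Spaces.linear_iff
      by (simp add: alg.vector_space_axioms A.coord_add A.coord_scale alg.scale_left_distrib)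
    then obtain f where f: "\<And>c. ?T c = (\<Sum>b\<in>B. f b * act b c)" using operator_exists by blast
    have "(\<Sum>j\<in>C. sA (A.coord e (d j - d' j)) j) = (\<Sum>j\<in>C. ?T (d j - d' j) * j)"
      by (simp add: alg_scale_mult)
    also have "\<dots> = (\<Sum>b\<in>B. f b * (\<Sum>j\<in>C. act b (d j - d' j) * j))"
      unfolding f sum_distrib_left sum_distrib_right mult.assoc by (rule sum.swap)
    also have "\<dots> = 0" by (simp add: z)
    finally have "A.coord j (\<Sum>j\<in>C. sA (A.coord e (d j - d' j)) j) = 0" by simp
    moreover have "A.coord j (\<Sum>j\<in>C. sA (A.coord e (d j - d' j)) j)
        = (\<Sum>i\<in>C. if i = j then A.coord e (d i - d' i) else 0)"
      unfolding A.coord_sum by (intro sum.cong refl) (auto simp: A.coord_scale A.coord_basis)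
    ultimately show ?thesis using j A.finite_B by simp
  qed
  then have "d j - d' j = 0" by (rule A.coord_inject)
  then show ?thesis by simp
qed

text \<open>
  Composing the injective map \<open>d \<mapsto> (h \<mapsto> (\<Sum>j\<in>C. act h (d j) * j))\<close> with the bijection between
  maps from \<open>H\<close> to \<open>A\<close> and linear operators on \<open>A\<close> gives an injective endomorphism of \<open>End A\<close>,
  which is then onto.
\<close>

lemma sigma_exists:
  assumes l: "functional l"
  shows "\<exists>d. \<forall>h. (\<Sum>j\<in>C. act h (d j) * j) = sA (l h) 1"
proof -
  let ?g = "\<lambda>d h. \<Sum>j\<in>C. act h (d j) * j"
  let ?f = "\<lambda>d c. \<Sum>b\<in>B. ?g d b * act b c"
  have gl: "Vector_Spaces.linear sH sA (?g d)" for d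
    unfolding Vector_Spaces.linear_iff
    by (simp add: vector_space_axioms alg.vector_space_axioms act_linear_simps sum.distrib
        alg.scale_sum_right[symmetric])
  have op: "Vector_Spaces.linear sA sA (\<lambda>c. \<Sum>b\<in>B. g b * act b c)" for g
    unfolding Vector_Spaces.linear_iff
    by (simp add: alg.vector_space_axioms act_linear_simps sum.distrib alg.scale_sum_right[symmetric])
  obtain d where d: "?f d = (\<lambda>c. \<Sum>b\<in>B. sA (l b) 1 * act b c)"
  proof (rule A.inj_linear_on_End[OF _ _ _ op[of "\<lambda>b. sA (l b) 1"], of ?f])
    show "Vector_Spaces.linear (fun_scale sA) (fun_scale sA) ?f"
      unfolding Vector_Spaces.linear_iff
      by (simp add: vector_space_fun_scale alg.vector_space_axioms fun_eq_iff fun_scale_def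
          act_linear_simps sum.distrib alg.scale_sum_right[symmetric])
    show "Vector_Spaces.linear sA sA (?f d)" for d by (rule op)
    fix d assume dl: "Vector_Spaces.linear sA sA d" and "?f d = 0"
    then have "?g d b = 0" if "b \<in> B" for b
      using operator_unique[of "?g d", OF _ that] by (simp add: fun_eq_iff)
    then have "?g d h = 0" for h by (subst H.linear_expand[OF gl]) simp
    then have d0: "d j = 0" if "j \<in> C" for j
      using sigma_unique[of d "\<lambda>_. 0", OF _ that] act_scale[of _ 0 0] by simp
    show "d = 0"
      by (intro ext) (subst A.linear_expand[OF dl], simp add: d0)
  qed blast
  have "?g d b = sA (l b) 1" if "b \<in> B" for b
  proof -
    have "?g d b - sA (l b) 1 = 0"
      by (rule operator_unique[OF _ that, of "\<lambda>b. ?g d b - sA (l b) 1"])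
        (use d in \<open>simp add: left_diff_distrib sum_subtractf fun_eq_iff\<close>)
    then show ?thesis by simp
  qed
  moreover have "Vector_Spaces.linear sH sA (\<lambda>h. sA (l h) 1)"
    using l unfolding Vector_Spaces.linear_iff
    by (simp add: alg.vector_space_axioms alg.scale_left_distrib)
  ultimately have "?g d h = sA (l h) 1" for h
    using H.linear_eq_on_basis[OF gl] by blast
  then show ?thesis by blast
qed

definition \<sigma> :: "('h \<Rightarrow> 'k) \<Rightarrow> 'a \<Rightarrow> 'a" where
  "\<sigma> l = (SOME d. \<forall>h. (\<Sum>j\<in>C. act h (d j) * j) = sA (l h) 1)"

lemma sigma: "functional l \<Longrightarrow> (\<Sum>j\<in>C. act h (\<sigma> l j) * j) = sA (l h) 1"
  using someI_ex[OF sigma_exists] unfolding \<sigma>_def by blast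

lemma sigma_eqI:
  assumes "functional l" "\<And>h. (\<Sum>j\<in>C. act h (d j) * j) = sA (l h) 1" "j \<in> C"
  shows "\<sigma> l j = d j"
  by (rule sigma_unique) (simp_all add: assms sigma)

definition coeff :: "'a \<Rightarrow> 'a \<Rightarrow> 'h \<Rightarrow> 'k" where
  "coeff e a h = A.coord e (act h a)"

lemma functional_coeff: "functional (coeff e a)"
  by (simp add: functional_iff coeff_def act_linear_simps A.coord_add A.coord_scale)

lemma sigma_coeff_End:
  assumes j: "j \<in> C"
  shows "(\<lambda>a. \<sigma> (coeff e a) j) \<in> module_End sA act"
proof -
  have "\<sigma> (coeff e (a + c)) j = \<sigma> (coeff e a) j + \<sigma> (coeff e c) j" for a c
    by (rule sigma_eqI[OF functional_coeff _ j, where d = "\<lambda>j. \<sigma> (coeff e a) j + \<sigma> (coeff e c) j"])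
      (simp add: act_linear_simps sum.distrib sigma functional_coeff, simp add: coeff_def act_linear_simps A.coord_add)
  moreover have "\<sigma> (coeff e (sA k a)) j = sA k (\<sigma> (coeff e a) j)" for a k
    by (rule sigma_eqI[OF functional_coeff _ j, where d = "\<lambda>j. sA k (\<sigma> (coeff e a) j)"])
      (simp add: act_linear_simps alg.scale_sum_right[symmetric] sigma functional_coeff,
        simp add: coeff_def act_linear_simps A.coord_scale)
  moreover have "\<sigma> (coeff e (act g a)) j = act g (\<sigma> (coeff e a) j)" for a g
    by (rule sigma_eqI[OF functional_coeff _ j, where d = "\<lambda>j. act g (\<sigma> (coeff e a) j)"])
      (simp add: act_comp sigma functional_coeff, simp add: coeff_def act_comp)
  ultimately show ?thesis
    by (simp add: module_End_def Vector_Spaces.linear_iff alg.vector_space_axioms)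
qed

text \<open>
  Transported to functionals by means of \<open>\<sigma>\<close>, the operator \<open>T\<close> becomes a functional \<open>\<theta>\<close> on the
  dual of \<open>H\<close>, which is evaluation at some \<open>g\<close>.  Since \<open>T\<close> commutes with the endomorphisms
  \<open>a \<mapsto> \<sigma> (coeff e a) j\<close>, the values of \<open>\<theta>\<close> at matrix coefficients are the coordinates of
  \<open>T a\<close>.
\<close>

theorem double_centralizer:
  assumes T: "Vector_Spaces.linear sA sA T"
    and comm: "\<And>\<phi> a. \<phi> \<in> module_End sA act \<Longrightarrow> T (\<phi> a) = \<phi> (T a)"
  shows "\<exists>g. \<forall>a. T a = act g a"
proof -
  interpret T: Vector_Spaces.linear sA sA T by fact
  define \<theta> where "\<theta> l = (\<Sum>j\<in>C. A.coord 1 (T (\<sigma> l j) * j))" for l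
  define g where "g = (\<Sum>b\<in>B. sH (\<theta> (H.coord b)) b)"
  have \<theta>: "\<theta> l = l g" if l: "functional l" for l
  proof -
    interpret l: Vector_Spaces.linear sH "(*)" l by fact
    have \<sigma>l: "\<sigma> l j = (\<Sum>b\<in>B. sA (l b) (\<sigma> (H.coord b) j))" if "j \<in> C" for j
    proof (rule sigma_eqI[OF l _ that])
      fix h
      have "(\<Sum>j\<in>C. act h (\<Sum>b\<in>B. sA (l b) (\<sigma> (H.coord b) j)) * j)
          = (\<Sum>b\<in>B. sA (l b) (\<Sum>j\<in>C. act h (\<sigma> (H.coord b) j) * j))"
        unfolding act_sum sum_distrib_right alg.scale_sum_right
        by (subst sum.swap) (simp add: act_linear_simps)
      also have "\<dots> = sA (\<Sum>b\<in>B. H.coord b h * l b) 1"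
        by (simp add: sigma H.linear_coord alg.scale_sum_left mult.commute)
      also have "\<dots> = sA (l h) 1"
        using H.linear_expand[OF l, of h] by simp
      finally show "(\<Sum>j\<in>C. act h (\<Sum>b\<in>B. sA (l b) (\<sigma> (H.coord b) j)) * j) = sA (l h) 1" .
    qed
    have "\<theta> l = (\<Sum>j\<in>C. \<Sum>b\<in>B. l b * A.coord 1 (T (\<sigma> (H.coord b) j) * j))"
      by (simp add: \<theta>_def \<sigma>l T.sum T.scale sum_distrib_right alg_scale_mult A.coord_sum A.coord_scale)
    also have "\<dots> = (\<Sum>b\<in>B. l b * \<theta> (H.coord b))"
      by (subst sum.swap) (simp add: \<theta>_def sum_distrib_left)
    also have "\<dots> = l g"
      by (simp add: g_def l.sum l.scale mult.commute)
    finally show ?thesis .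
  qed
  have "T a = act g a" for a
  proof (rule A.coord_inject)
    fix e assume "e \<in> C"
    have "A.coord e (act g a) = \<theta> (coeff e a)"
      by (simp add: \<theta> functional_coeff) (simp add: coeff_def)
    also have "\<dots> = A.coord 1 (\<Sum>j\<in>C. act 1 (\<sigma> (coeff e (T a)) j) * j)"
      unfolding \<theta>_def A.coord_sum
      by (intro sum.cong refl) (simp add: comm[OF sigma_coeff_End] act_e)
    also have "\<dots> = A.coord e (T a)"
      by (simp only: sigma functional_coeff A.coord_scalar) (simp add: coeff_def act_e)
    finally show "A.coord e (T a) = A.coord e (act g a)" by simp
  qed
  then show ?thesis by blast
qed

text \<open>
  Expanding \<open>g (a * c)\<close> by the comultiplication and \<open>(g a) * (g c)\<close> by linearity in \<open>g\<close>, and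
  comparing the coefficients of the operators \<open>c \<mapsto> b c\<close>, shows \<open>D b g = coord b g * g\<close>.
\<close>

lemma grouplikeI:
  assumes one: "act g 1 = 1" and mult: "\<And>a c. act g (a * c) = act g a * act g c"
  shows "grouplike sH \<Delta> \<epsilon> g"
proof -
  have D: "D b g = sH (H.coord b g) g" if b: "b \<in> B" for b
  proof (rule act_faithful)
    fix a
    have "act (D b g) a - sA (H.coord b g) (act g a) = 0"
    proof (rule operator_unique[OF _ b])
      fix c
      have "(\<Sum>b\<in>B. act (D b g) a * act b c) = act g a * act g c"
        by (simp add: act_mult[symmetric] mult)
      also have "\<dots> = (\<Sum>b\<in>B. sA (H.coord b g) (act g a) * act b c)"
        by (subst (2) H.linear_expand[OF linear_act_left]) (simp add: sum_distrib_left alg_scale_mult)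
      finally show "(\<Sum>b\<in>B. (act (D b g) a - sA (H.coord b g) (act g a)) * act b c) = 0"
        by (simp add: left_diff_distrib sum_subtractf)
    qed
    then show "act (D b g) a = act (sH (H.coord b g) g) a" by (simp add: act_scale_left)
  qed
  let ?t = "tensor sH (UNIV :: 'h set) sH UNIV"
  let ?s = "fun_scale (*) :: 'k \<Rightarrow> (('h \<Rightarrow> 'h \<Rightarrow> 'k) \<Rightarrow> 'k) \<Rightarrow> (('h \<Rightarrow> 'h \<Rightarrow> 'k) \<Rightarrow> 'k)"
  have s: "vector_space ?s" by (rule vector_space_fun_scale[OF vector_space_times])
  have t: "bilin ?s ?t" by (rule bilinear_tensor)
  obtain xs where xs: "\<Delta> g = (\<Sum>(x, y)\<leftarrow>xs. ?t x y)"
    using comul_closed[of g] unfolding tensor_space_def by auto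
  have tl: "Vector_Spaces.linear sH ?s (?t g)"
    using t vector_space_axioms s
    unfolding bilinear_on_def linear_on_def Vector_Spaces.linear_iff by blast
  have "\<Delta> g = sw ?t g"
    using tensor_lift_sum_list[OF s t, of xs] by (simp add: xs)
  also have "\<dots> = (\<Sum>b\<in>B. ?t (D b g) b)" by (rule sw_sum[OF s t])
  also have "\<dots> = (\<Sum>b\<in>B. ?s (H.coord b g) (?t g b))"
    using t D by (intro sum.cong refl) (simp add: bilinear_on_def linear_on_def)
  also have "\<dots> = ?t g g" by (rule H.linear_expand[OF tl, symmetric])
  finally have "\<Delta> g = ?t g g" .
  moreover have "\<epsilon> g = 1"
    using act_one[of g] one A.coord_scalar[of "\<epsilon> g"] A.coord_one by simp
  ultimately show ?thesis by (simp add: grouplike_def)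
qed

end


section \<open>The invariant form and its Nakayama automorphism\<close>

locale galois_integral = galois_action sH \<Delta> \<epsilon> S sA act B C
  for sH :: "'k::field \<Rightarrow> 'h::ring_1 \<Rightarrow> 'h" and \<Delta> \<epsilon> S
    and sA :: "'k \<Rightarrow> 'a::ring_1 \<Rightarrow> 'a" and act B C +
  fixes x :: 'h and \<alpha> :: "'h \<Rightarrow> 'k"
  assumes x_nonzero: "x \<noteq> 0" and integral: "h * x = sH (\<epsilon> h) x"
    and modular: "x * h = sH (\<alpha> h) x" and functional_\<alpha>: "functional \<alpha>"
begin

text \<open>
  The multiples of \<open>x\<close> in \<open>A\<close> are invariant, hence scalars: \<open>x a = t a * 1\<close>.
\<close>

definition t :: "'a \<Rightarrow> 'k" where
  "t a = A.coord 1 (act x a)"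

lemma act_integral: "act x a = sA (t a) 1"
  unfolding t_def by (rule invariant_scalar) (simp add: act_comp integral act_scale_left)

lemma linear_t: "Vector_Spaces.linear sA (*) t"
  by (simp add: Vector_Spaces.linear_iff alg.vector_space_axioms vector_space_times t_def
      act_linear_simps A.coord_add A.coord_scale)

sublocale t: Vector_Spaces.linear sA "(*)" t
  by (rule linear_t)

lemma t_act: "t (act h a) = \<alpha> h * t a"
  by (simp add: t_def act_comp modular act_scale_left A.coord_scale)

lemma t_nonzero: "\<exists>a. t a \<noteq> 0"
proof (rule ccontr)
  assume "\<not> (\<exists>a. t a \<noteq> 0)"
  then have "act x c = act 0 c" for c
    using act_integral[of c] act_scale_left[of 0 0 c] by simp
  then have "x = 0" by (rule act_faithful)
  then show False using x_nonzero by simp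
qed

text \<open>
  By \<open>times_act_sum\<close>, \<open>t (a * h c)\<close> is a combination of values of \<open>t\<close> at elements \<open>a' * c\<close>.  So
  the right radical of the form is stable under \<open>H\<close>, hence under all linear operators.
\<close>

lemma t_nondegenerate:
  assumes c: "\<And>a. t (a * c) = 0"
  shows "c = 0"
proof (rule ccontr)
  assume "c \<noteq> 0"
  then obtain e where e: "A.coord e c \<noteq> 0" using A.coord_inject[of c 0] by auto
  have act0: "t (a * act h c) = 0" for a h
    by (simp add: times_act_sum t.sum t_act c)
  have "t y = 0" for y
  proof -
    \<comment> \<open>a linear operator that maps \<open>c\<close> to \<open>y\<close>\<close>
    let ?T = "\<lambda>z. sA (A.coord e z / A.coord e c) y"
    have "Vector_Spaces.linear sA sA ?T"
      unfolding Vector_Spaces.linear_iff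
      by (simp add: alg.vector_space_axioms A.coord_add A.coord_scale add_divide_distrib
          alg.scale_left_distrib)
    then obtain f where "\<And>z. ?T z = (\<Sum>b\<in>B. f b * act b z)" using operator_exists by blast
    from this[of c] have "y = (\<Sum>b\<in>B. f b * act b c)" using e by simp
    then show ?thesis by (simp add: t.sum act0)
  qed
  then show False using t_nonzero by blast
qed

lemma A_inj_imp_surj:
  assumes f: "Vector_Spaces.linear sA sA f" and inj: "\<And>a. f a = 0 \<Longrightarrow> a = 0"
  shows "surj f" "inj f"
proof -
  interpret f: Vector_Spaces.linear sA sA f by fact
  show i: "inj f"
  proof (rule injI)
    fix a b assume "f a = f b"
    then have "f (a - b) = 0" by (simp add: f.diff)
    then show "a = b" using inj[of "a - b"] by simp
  qed
  show "surj f"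
    using alg.inj_linear_image_subspace[OF f alg.subspace_UNIV A.finite_B] A.span_B i by simp
qed

lemma t_riesz:
  assumes l: "Vector_Spaces.linear sA (*) l"
  obtains c where "\<And>a. l a = t (a * c)"
proof -
  let ?f = "\<lambda>c. \<Sum>e\<in>C. sA (t (e * c)) e"
  have coord: "A.coord e (\<Sum>e\<in>C. sA (g e) e) = g e" if "e \<in> C" for g e
  proof -
    have "A.coord e (\<Sum>e\<in>C. sA (g e) e) = (\<Sum>i\<in>C. if i = e then g i else 0)"
      unfolding A.coord_sum by (intro sum.cong refl) (auto simp: A.coord_scale A.coord_basis)
    then show ?thesis using that A.finite_B by simp
  qed
  have rl: "Vector_Spaces.linear sA (*) (\<lambda>a. t (a * c))" for c
    by (simp add: Vector_Spaces.linear_iff alg.vector_space_axioms vector_space_times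
        act_linear_simps t.add t.scale)
  have lin: "Vector_Spaces.linear sA sA ?f"
    unfolding Vector_Spaces.linear_iff
    by (simp add: alg.vector_space_axioms act_linear_simps t.add t.scale sum.distrib
        alg.scale_sum_right)
  have "surj ?f"
  proof (rule A_inj_imp_surj(1)[OF lin])
    fix c assume z: "?f c = 0"
    have "t (e * c) = 0" if "e \<in> C" for e
      using coord[OF that, of "\<lambda>e. t (e * c)"] z by simp
    then have "t (a * c) = 0" for a
      by (subst A.linear_expand[OF rl]) simp
    then show "c = 0" by (rule t_nondegenerate)
  qed
  then obtain c where c: "(\<Sum>e\<in>C. sA (l e) e) = ?f c" by (rule surjE)
  have "l e = t (e * c)" if "e \<in> C" for e
    using coord[OF that, of l] coord[OF that, of "\<lambda>e. t (e * c)"] c by simp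
  then have "l a = t (a * c)" for a by (rule A.linear_eq_on_basis[OF l rl])
  then show ?thesis by (rule that)
qed

lemma t_nondegenerate':
  assumes a: "\<And>c. t (a * c) = 0"
  shows "a = 0"
proof (rule A.coord_inject)
  fix e assume "e \<in> C"
  obtain c where "\<And>b. A.coord e b = t (b * c)" using t_riesz[OF A.linear_coord] by blast
  then show "A.coord e a = A.coord e 0" using a by simp
qed

lemma t_eqI: "(\<And>a. t (a * c) = t (a * d)) \<Longrightarrow> c = d"
  using t_nondegenerate[of "c - d"] by (simp add: right_diff_distrib t.diff)

definition \<nu> :: "'a \<Rightarrow> 'a" where
  "\<nu> a = (SOME c. \<forall>b. t (a * b) = t (b * c))"

lemma nu: "t (a * b) = t (b * \<nu> a)"
proof -
  have "Vector_Spaces.linear sA (*) (\<lambda>b. t (a * b))"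
    by (simp add: Vector_Spaces.linear_iff alg.vector_space_axioms vector_space_times
        act_linear_simps t.add t.scale)
  then have "\<exists>c. \<forall>b. t (a * b) = t (b * c)" using t_riesz by metis
  then have "\<forall>b. t (a * b) = t (b * \<nu> a)" unfolding \<nu>_def by (rule someI_ex)
  then show ?thesis ..
qed

lemma nu_eqI: "(\<And>b. t (a * b) = t (b * c)) \<Longrightarrow> \<nu> a = c"
  by (rule t_eqI) (simp add: nu[symmetric])

lemma nu_mult: "\<nu> (a * b) = \<nu> a * \<nu> b"
  by (rule nu_eqI) (metis nu mult.assoc)

lemma nu_one: "\<nu> 1 = 1"
  by (rule nu_eqI) simp

lemma linear_nu: "Vector_Spaces.linear sA sA \<nu>"
  unfolding Vector_Spaces.linear_iff
proof (intro conjI allI alg.vector_space_axioms)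
  show "\<nu> (a + b) = \<nu> a + \<nu> b" for a b
    by (rule nu_eqI) (simp add: distrib_left distrib_right t.add nu[of a] nu[of b])
  show "\<nu> (sA c a) = sA c (\<nu> a)" for c a
    by (rule nu_eqI) (simp add: alg_scale_mult t.scale nu[of a])
qed

lemma nu_zero: "\<nu> a = 0 \<Longrightarrow> a = 0"
  by (rule t_nondegenerate') (simp add: nu[of a] t.zero)

lemma bij_nu: "bij \<nu>"
  using A_inj_imp_surj[OF linear_nu nu_zero] by (simp add: bij_def)

text \<open>
  Both \<open>t (h a * b)\<close> and \<open>t (b * h (\<nu> a))\<close> are equal to \<open>\<alpha> h' * t (a * S h'' b)\<close>.
\<close>

lemma nu_act: "\<nu> (act h a) = act h (\<nu> a)"
proof (rule nu_eqI)
  fix b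
  have "t (act h a * b) = (\<Sum>c\<in>B. \<alpha> (D c h) * t (act (S c) b * \<nu> a))"
    by (simp add: act_times_sum t.sum t_act nu[of a])
  also have "\<dots> = t (b * act h (\<nu> a))"
    by (simp add: times_act_sum t.sum t_act)
  finally show "t (act h a * b) = t (b * act h (\<nu> a))" .
qed

lemma nu_inner: "\<exists>v w. v * w = 1 \<and> w * v = 1 \<and> (\<forall>y. y * v = v * \<nu> y)"
proof -
  obtain u v where uv: "u * v = 1" "v * u = 1" "\<And>x. \<nu> x = u * x * v"
    using A.Skolem_Noether[OF linear_nu nu_mult bij_nu] by blast
  have "v * \<nu> y = y * v" for y
    by (simp only: uv(3) mult.assoc[symmetric] uv(2) mult_1_left)
  then show ?thesis using uv by metis
qed

text \<open>
  A unit with \<open>\<nu> y = w * y * v\<close>, where \<open>w\<close> is the inverse of \<open>v\<close>.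
\<close>

definition v :: 'a where
  "v = (SOME v. \<exists>w. v * w = 1 \<and> w * v = 1 \<and> (\<forall>y. y * v = v * \<nu> y))"

definition w :: 'a where
  "w = (SOME w. v * w = 1 \<and> w * v = 1 \<and> (\<forall>y. y * v = v * \<nu> y))"

lemma vw: "v * w = 1" and wv: "w * v = 1" and v_nu: "y * v = v * \<nu> y"
proof -
  have "\<exists>w. v * w = 1 \<and> w * v = 1 \<and> (\<forall>y. y * v = v * \<nu> y)"
    unfolding v_def by (rule someI_ex[OF nu_inner])
  then have "v * w = 1 \<and> w * v = 1 \<and> (\<forall>y. y * v = v * \<nu> y)"
    unfolding w_def by (rule someI_ex)
  then show "v * w = 1" "w * v = 1" "y * v = v * \<nu> y" by blast+
qed

lemma nu_v: "\<nu> v = v"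
proof -
  have "w * (v * v) = w * (v * \<nu> v)" using v_nu[of v] by simp
  then show ?thesis by (simp add: mult.assoc[symmetric] wv)
qed

text \<open>
  A multiple of the reduced trace: twisting \<open>t\<close> by \<open>v\<close> compensates \<open>\<nu>\<close>.
\<close>

definition tr :: "'a \<Rightarrow> 'k" where
  "tr a = t (v * a)"

lemma linear_tr: "Vector_Spaces.linear sA (*) tr"
  by (simp add: Vector_Spaces.linear_iff alg.vector_space_axioms vector_space_times tr_def
      act_linear_simps t.add t.scale)

sublocale tr: Vector_Spaces.linear sA "(*)" tr
  by (rule linear_tr)

lemma tr_commute: "tr (a * b) = tr (b * a)"
proof -
  have "tr (a * b) = t (v * a * b)" by (simp add: tr_def mult.assoc)
  also have "\<dots> = t (b * (\<nu> v * \<nu> a))" by (simp only: nu[of "v * a"] nu_mult)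
  also have "\<dots> = t (b * (a * v))" by (simp only: nu_v v_nu[of a])
  also have "\<dots> = t (b * a * \<nu> v)" by (simp add: nu_v mult.assoc)
  also have "\<dots> = tr (b * a)" by (simp add: nu[symmetric] tr_def)
  finally show ?thesis .
qed

lemma tr_nonzero: "\<exists>a. tr a \<noteq> 0"
proof -
  obtain a where "t a \<noteq> 0" using t_nonzero by blast
  then have "tr (w * a) \<noteq> 0" by (simp add: tr_def mult.assoc[symmetric] vw)
  then show ?thesis by blast
qed

lemma tr_nondegenerate: "(\<And>b. tr (a * b) = 0) \<Longrightarrow> a = 0"
proof -
  assume "\<And>b. tr (a * b) = 0"
  then have "v * a = 0"
    by (intro t_nondegenerate') (simp add: tr_def mult.assoc)
  then have "w * (v * a) = 0" by simp
  then show "a = 0" by (simp add: mult.assoc[symmetric] wv)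
qed

text \<open>
  By nondegeneracy \<open>l a = tr (d * a)\<close> for some \<open>d\<close>, and symmetry of both forms makes \<open>d\<close> central.
\<close>

lemma symmetric_form_unique:
  assumes l: "Vector_Spaces.linear sA (*) l" and sym: "\<And>a b. l (a * b) = l (b * a)"
  shows "\<exists>k. \<forall>a. l a = k * tr a"
proof -
  obtain c where c: "\<And>a. l a = t (a * c)" using t_riesz[OF l] by blast
  define d where "d = c * w"
  have ld: "l a = tr (d * a)" for a
  proof -
    have "l a = tr (w * (a * c))" by (simp add: c tr_def mult.assoc[symmetric] vw)
    also have "\<dots> = tr (a * d)" using tr_commute[of w "a * c"] by (simp add: d_def mult.assoc)
    finally show ?thesis by (simp add: tr_commute)
  qed
  have "d * a = a * d" for a
  proof -
    have "tr ((d * a - a * d) * b) = 0" for b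
    proof -
      have "tr (a * d * b) = tr (d * (b * a))"
        using tr_commute[of a "d * b"] by (simp add: mult.assoc)
      also have "\<dots> = tr (d * (a * b))" using sym[of a b] by (simp add: ld)
      finally show ?thesis by (simp add: left_diff_distrib tr.diff mult.assoc)
    qed
    then have "d * a - a * d = 0" by (rule tr_nondegenerate)
    then show ?thesis by simp
  qed
  then have "d = sA (A.coord 1 d) 1" using A.scalar_coord[of d] by simp
  then have "l a = A.coord 1 d * tr a" for a
    using ld[of a] by (metis alg_scale_mult(1) mult_1_left tr.scale)
  then show ?thesis by blast
qed

text \<open>
  By cocommutativity \<open>h\<close> maps commutators to sums of commutators, so \<open>a \<mapsto> tr (h a)\<close> is again
  symmetric and therefore a multiple \<open>\<beta> h\<close> of \<open>tr\<close>.
\<close>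

lemma tr_invariant: "tr (act h a) = \<epsilon> h * tr a"
proof -
  obtain a0 where a0: "tr a0 \<noteq> 0" using tr_nonzero by blast
  define \<beta> where "\<beta> h = tr (act h a0) / tr a0" for h
  have \<beta>: "tr (act h a) = \<beta> h * tr a" for h a
  proof -
    have "\<exists>k. \<forall>a. tr (act h a) = k * tr a"
    proof (rule symmetric_form_unique)
      show "Vector_Spaces.linear sA (*) (\<lambda>a. tr (act h a))"
        by (simp add: Vector_Spaces.linear_iff alg.vector_space_axioms vector_space_times
            act_linear_simps tr.add tr.scale)
      fix a b
      have "tr (act h (a * b)) = (\<Sum>c\<in>B. tr (act c b * act (D c h) a))"
        by (simp add: act_mult tr.sum tr_commute[of "act (D c h) a" for c])
      also have "\<dots> = (\<Sum>c\<in>B. tr (act (D c h) b * act c a))"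
        by (rule cocomm_sum[OF vector_space_times, where f = "\<lambda>x y. tr (act x b * act y a)", symmetric])
          (simp add: multilinear tr.add tr.scale)
      also have "\<dots> = tr (act h (b * a))" by (simp add: act_mult tr.sum)
      finally show "tr (act h (a * b)) = tr (act h (b * a))" .
    qed
    then obtain k where k: "\<And>a. tr (act h a) = k * tr a" by blast
    then have "\<beta> h = k" using a0 by (simp add: \<beta>_def)
    then show ?thesis using k by simp
  qed
  have "functional \<beta>"
    by (simp add: functional_iff \<beta>_def act_linear_simps tr.add tr.scale add_divide_distrib)
  then have "\<beta> = \<epsilon>" using trace_invariant[OF linear_tr tr_commute a0 _ \<beta>] by blast
  then show ?thesis using \<beta> by simp
qed

text \<open>
  As \<open>\<nu>\<close> commutes with \<open>H\<close>, the element \<open>h v\<close> satisfies \<open>y * h v = h v * \<nu> y\<close> like \<open>v\<close> itself, so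
  it is a multiple \<open>\<chi> h\<close> of \<open>v\<close>.  Computing \<open>t (h (v * a))\<close> by the product rule and the
  invariance of \<open>tr\<close> yields \<open>\<chi> h * tr a\<close>.
\<close>

lemma v_weight: "act h v = sA (\<alpha> h) v"
proof -
  define \<chi> where "\<chi> h = A.coord 1 (act h v * w)" for h
  have \<chi>: "act h v = sA (\<chi> h) v" for h
  proof -
    have y: "y * act h v = act h v * \<nu> y" for y
    proof -
      have "y * act h v = (\<Sum>b\<in>B. act (D b h) (v * act (S b) (\<nu> y)))"
        by (simp only: times_act_sum[of y h v] v_nu nu_act)
      also have "\<dots> = act h v * \<nu> y" by (simp only: act_times_sum)
      finally show ?thesis .
    qed
    have nw: "\<nu> y * w = w * y" for y
    proof -
      have "\<nu> y * w = w * (v * \<nu> y) * w" by (simp add: mult.assoc[symmetric] wv)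
      also have "\<dots> = w * (y * (v * w))" by (simp only: v_nu[symmetric] mult.assoc)
      finally show ?thesis by (simp add: vw)
    qed
    have "act h v * w * y = y * (act h v * w)" for y
      by (simp only: mult.assoc nw[symmetric]) (simp only: mult.assoc[symmetric] y)
    then have "act h v * w = sA (\<chi> h) 1" unfolding \<chi>_def by (rule A.scalar_coord[symmetric])
    then have "act h v * w * v = sA (\<chi> h) v" by (simp add: alg_scale_mult)
    then show ?thesis by (simp add: mult.assoc wv)
  qed
  have f\<chi>: "functional \<chi>"
    by (simp add: functional_iff \<chi>_def act_linear_simps A.coord_add A.coord_scale)
  obtain a where a: "tr a \<noteq> 0" using tr_nonzero by blast
  have "\<alpha> h * tr a = t (act h (v * a))" by (simp add: tr_def t_act)
  also have "\<dots> = (\<Sum>b\<in>B. \<chi> (D b h) * tr (act b a))"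
    by (simp add: act_mult \<chi> alg_scale_mult t.sum t.scale tr_def)
  also have "\<dots> = conv \<chi> \<epsilon> h * tr a"
    unfolding conv_def sum_distrib_right by (intro sum.cong refl) (simp only: tr_invariant mult.assoc)
  also have "\<dots> = \<chi> h * tr a" by (simp only: conv_counit[OF f\<chi>])
  finally show ?thesis using a \<chi> by simp
qed

primrec \<alpha>pow :: "nat \<Rightarrow> 'h \<Rightarrow> 'k" where
  "\<alpha>pow 0 = \<epsilon>"
| "\<alpha>pow (Suc m) = conv (\<alpha>pow m) \<alpha>"

lemma v_pow_weight: "act h (v ^ m) = sA (\<alpha>pow m h) (v ^ m)"
proof (induction m arbitrary: h)
  case 0
  then show ?case by (simp add: act_one)
next
  case (Suc m)
  have "act h (v ^ Suc m) = (\<Sum>b\<in>B. act (D b h) (v ^ m) * act b v)"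
    unfolding power_Suc2 by (rule act_mult)
  also have "\<dots> = (\<Sum>b\<in>B. sA (\<alpha>pow m (D b h) * \<alpha> b) (v ^ Suc m))"
    unfolding power_Suc2 by (simp add: Suc v_weight alg_scale_mult mult.commute)
  also have "\<dots> = sA (\<alpha>pow (Suc m) h) (v ^ Suc m)"
    by (simp only: \<alpha>pow.simps conv_def alg.scale_sum_left)
  finally show ?case .
qed

lemma wv_pow: "w ^ m * v ^ m = 1"
proof (induction m)
  case (Suc m)
  have "w ^ Suc m * v ^ Suc m = w ^ m * (w * v) * v ^ m"
    unfolding power_Suc2[of w] power_Suc[of v] by (simp only: mult.assoc)
  then show ?case by (simp add: wv Suc)
qed simp

lemma v_pow_nu: "y * v ^ m = v ^ m * (\<nu> ^^ m) y"
proof (induction m)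
  case (Suc m)
  have "y * v ^ Suc m = v ^ m * ((\<nu> ^^ m) y * v)"
    unfolding power_Suc2 by (simp only: mult.assoc[symmetric] Suc)
  also have "\<dots> = v ^ Suc m * (\<nu> ^^ Suc m) y"
    unfolding power_Suc2 by (simp only: v_nu[of "(\<nu> ^^ m) y"] mult.assoc funpow.simps comp_apply)
  finally show ?case .
qed simp

text \<open>
  Both conditions say that \<open>v\<^sup>m\<close> is a scalar: the first because the centre of \<open>A\<close> consists of
  scalars, the second because its invariants do.
\<close>

theorem nu_pow_eq_id_iff: "(\<nu> ^^ m) = id \<longleftrightarrow> \<alpha>pow m = \<epsilon>"
proof
  have v0: "v ^ m \<noteq> 0" using wv_pow[of m] by auto
  {
    assume "(\<nu> ^^ m) = id"
    then have "v ^ m * y = y * v ^ m" for y using v_pow_nu[of y m] by simp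
    then have c: "sA (A.coord 1 (v ^ m)) 1 = v ^ m" by (rule A.scalar_coord)
    have "act h (sA c 1) = sA (\<epsilon> h) (sA c 1)" for c h
      by (simp add: act_scale act_one mult.commute)
    from this[of _ "A.coord 1 (v ^ m)"] have "act h (v ^ m) = sA (\<epsilon> h) (v ^ m)" for h
      unfolding c .
    then have "\<alpha>pow m h = \<epsilon> h" for h
      using v_pow_weight[of h m] v0 by simp
    then show "\<alpha>pow m = \<epsilon>" by blast
  }
  assume "\<alpha>pow m = \<epsilon>"
  then have c: "v ^ m = sA (A.coord 1 (v ^ m)) 1"
    by (intro invariant_scalar) (simp add: v_pow_weight)
  have "v ^ m * y = y * v ^ m" for y by (subst (1 2) c) (rule A.scalar_commute)
  then have "w ^ m * (v ^ m * y) = w ^ m * (v ^ m * (\<nu> ^^ m) y)" for y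
    using v_pow_nu[of y m] by simp
  then have "y = (\<nu> ^^ m) y" for y
    unfolding mult.assoc[symmetric] wv_pow by simp
  then show "(\<nu> ^^ m) = id" by (simp add: fun_eq_iff)
qed

lemma nu_pow_act: "(\<nu> ^^ m) (act h a) = act h ((\<nu> ^^ m) a)"
  by (induction m) (simp_all add: nu_act)

lemma nu_pow_mult: "(\<nu> ^^ m) (a * b) = (\<nu> ^^ m) a * (\<nu> ^^ m) b"
  by (induction m) (simp_all add: nu_mult)

lemma nu_pow_one: "(\<nu> ^^ m) 1 = 1"
  by (induction m) (simp_all add: nu_one)

lemma linear_nu_pow: "Vector_Spaces.linear sA sA (\<nu> ^^ m)"
  using linear_nu unfolding Vector_Spaces.linear_iff by (induction m) simp_all

lemma central_nu_pow_grouplike: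
  assumes comm: "\<And>\<phi> a. \<phi> \<in> module_End sA act \<Longrightarrow> (\<nu> ^^ m) (\<phi> a) = \<phi> ((\<nu> ^^ m) a)"
  obtains g where "\<And>a. (\<nu> ^^ m) a = act g a" "grouplike sH \<Delta> \<epsilon> g" "\<And>h. g * h = h * g"
proof -
  obtain g where g: "\<And>a. (\<nu> ^^ m) a = act g a"
    using double_centralizer[OF linear_nu_pow comm] by blast
  have "grouplike sH \<Delta> \<epsilon> g"
    by (rule grouplikeI) (simp_all add: g[symmetric] nu_pow_mult nu_pow_one)
  moreover have "g * h = h * g" for h
    by (rule act_faithful) (simp add: act_comp[symmetric] g[symmetric] nu_pow_act)
  ultimately show ?thesis using g that by blast
qed

section \<open>The antipode of the endomorphism Hopf algebra\<close>

text \<open>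
  The endomorphisms commute with \<open>x\<close>, so \<open>t\<close> is invariant under \<open>E\<close> and the antipode of \<open>E\<close> is the
  adjoint: \<open>t (\<phi> a * b) = t (a * SE \<phi> b)\<close>.  Taking the adjoint twice exchanges the two sides of
  the form, which introduces \<open>\<nu>\<close>.
\<close>

lemma antipode_square:
  assumes E: "module_algebra (fun_scale sA) (module_End sA act) (\<circ>) id \<Delta>E \<epsilon>E SE sA (\<lambda>\<phi> a. \<phi> a)"
    and \<phi>: "\<phi> \<in> module_End sA act"
  shows "SE (SE \<phi>) \<in> module_End sA act" "SE (SE \<phi>) (\<nu> a) = \<nu> (\<phi> a)"
proof -
  interpret E: module_algebra "fun_scale sA" "module_End sA act" "(\<circ>)" id \<Delta>E \<epsilon>E SE sA "\<lambda>\<phi> a. \<phi> a"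
    by (rule E)
  have inv: "t (\<psi> a) = \<epsilon>E \<psi> * t a" if "\<psi> \<in> module_End sA act" for \<psi> a
  proof -
    have lin: "Vector_Spaces.linear sA sA \<psi>" and com: "\<psi> (act x a) = act x (\<psi> a)"
      using that by (simp_all add: module_End_def)
    interpret \<psi>: Vector_Spaces.linear sA sA \<psi> by (rule lin)
    have "sA (t (\<psi> a)) 1 = \<psi> (sA (t a) 1)" using com by (simp add: act_integral)
    also have "\<dots> = sA (t a) (sA (\<epsilon>E \<psi>) 1)" by (simp add: \<psi>.scale E.act_one[OF that])
    also have "\<dots> = sA (\<epsilon>E \<psi> * t a) 1" by (simp add: mult.commute)
    finally show ?thesis by (metis A.coord_scalar)
  qed
  have adj: "t (\<psi> a * c) = t (a * SE \<psi> c)" if "\<psi> \<in> module_End sA act" for \<psi> a c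
    by (rule E.invariant_form_antipode[OF linear_t inv that])
  show SS: "SE (SE \<phi>) \<in> module_End sA act" using \<phi> by (simp add: E.antipode_closed)
  show "SE (SE \<phi>) (\<nu> a) = \<nu> (\<phi> a)"
  proof (rule nu_eqI[symmetric])
    fix b
    have "t (\<phi> a * b) = t (a * SE \<phi> b)" by (rule adj[OF \<phi>])
    also have "\<dots> = t (SE \<phi> b * \<nu> a)" by (rule nu)
    also have "\<dots> = t (b * SE (SE \<phi>) (\<nu> a))" by (rule adj[OF E.antipode_closed[OF \<phi>]])
    finally show "t (\<phi> a * b) = t (b * SE (SE \<phi>) (\<nu> a))" .
  qed
qed

lemma antipode_square_pow:
  assumes E: "module_algebra (fun_scale sA) (module_End sA act) (\<circ>) id \<Delta>E \<epsilon>E SE sA (\<lambda>\<phi> a. \<phi> a)"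
    and \<phi>: "\<phi> \<in> module_End sA act"
  shows "((SE ^^ 2) ^^ m) \<phi> \<in> module_End sA act \<and>
    (\<forall>a. ((SE ^^ 2) ^^ m) \<phi> ((\<nu> ^^ m) a) = (\<nu> ^^ m) (\<phi> a))"
proof (induction m)
  case (Suc m)
  have "((SE ^^ 2) ^^ Suc m) \<phi> = SE (SE (((SE ^^ 2) ^^ m) \<phi>))"
    by (simp add: numeral_2_eq_2)
  then show ?case
    using Suc antipode_square[OF E, of "((SE ^^ 2) ^^ m) \<phi>"] by simp
qed (simp add: \<phi>)

theorem antipode_square_pow_eq_id:
  assumes E: "module_algebra (fun_scale sA) (module_End sA act) (\<circ>) id \<Delta>E \<epsilon>E SE sA (\<lambda>\<phi> a. \<phi> a)"
    and m: "\<alpha>pow m = \<epsilon>" and \<phi>: "\<phi> \<in> module_End sA act"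
  shows "((SE ^^ 2) ^^ m) \<phi> = \<phi>"
proof
  fix a
  have "(\<nu> ^^ m) = id" using m by (simp add: nu_pow_eq_id_iff)
  then show "((SE ^^ 2) ^^ m) \<phi> a = \<phi> a"
    using antipode_square_pow[OF E \<phi>, of m] by simp
qed

text \<open>
  If the \<open>m\<close>-th power of \<open>S\<^sup>2\<close> is the identity, then \<open>\<nu>\<^sup>m\<close> commutes with \<open>E\<close>, so it is the action of a
  central grouplike element.
\<close>

theorem antipode_square_pow_eq_id_converse:
  assumes E: "module_algebra (fun_scale sA) (module_End sA act) (\<circ>) id \<Delta>E \<epsilon>E SE sA (\<lambda>\<phi> a. \<phi> a)"
    and m: "\<And>\<phi>. \<phi> \<in> module_End sA act \<Longrightarrow> ((SE ^^ 2) ^^ m) \<phi> = \<phi>"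
    and central: "\<And>g. grouplike sH \<Delta> \<epsilon> g \<Longrightarrow> (\<And>h. g * h = h * g) \<Longrightarrow> g = 1"
  shows "\<alpha>pow m = \<epsilon>"
proof -
  have "(\<nu> ^^ m) (\<phi> a) = \<phi> ((\<nu> ^^ m) a)" if "\<phi> \<in> module_End sA act" for \<phi> a
    using antipode_square_pow[OF E that, of m] m[OF that] by simp
  then obtain g where g: "\<And>a. (\<nu> ^^ m) a = act g a" "grouplike sH \<Delta> \<epsilon> g" "\<And>h. g * h = h * g"
    using central_nu_pow_grouplike by blast
  have "g = 1" by (rule central[OF g(2,3)])
  then have "(\<nu> ^^ m) = id" using g(1) by (simp add: act_e fun_eq_iff)
  then show ?thesis by (simp add: nu_pow_eq_id_iff)
qed

lemma antipode_square_bij: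
  assumes E: "module_algebra (fun_scale sA) (module_End sA act) (\<circ>) id \<Delta>E \<epsilon>E SE sA (\<lambda>\<phi> a. \<phi> a)"
  shows "bij_betw (SE ^^ 2) (module_End sA act) (module_End sA act)"
proof (rule bij_betw_imageI)
  let ?\<mu> = "inv_into UNIV \<nu>"
  have \<mu>: "\<nu> (?\<mu> a) = a" "?\<mu> (\<nu> a) = a" for a
    using bij_nu by (simp_all add: bij_is_surj surj_f_inv_f bij_is_inj)
  have SS: "(SE ^^ 2) \<phi> \<in> module_End sA act" "(SE ^^ 2) \<phi> a = \<nu> (\<phi> (?\<mu> a))"
    if "\<phi> \<in> module_End sA act" for \<phi> a
    using antipode_square[OF E that] \<mu>(1)[of a] by (simp_all add: numeral_2_eq_2, metis)
  show "inj_on (SE ^^ 2) (module_End sA act)"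
  proof (rule inj_onI)
    fix \<phi> \<psi> assume *: "\<phi> \<in> module_End sA act" "\<psi> \<in> module_End sA act" "(SE ^^ 2) \<phi> = (SE ^^ 2) \<psi>"
    show "\<phi> = \<psi>"
    proof
      fix a
      have "\<nu> (\<phi> (?\<mu> (\<nu> a))) = \<nu> (\<psi> (?\<mu> (\<nu> a)))" using SS(2)[OF *(1)] SS(2)[OF *(2)] *(3) by metis
      then show "\<phi> a = \<psi> a" by (metis \<mu>(2))
    qed
  qed
  have "\<psi> \<in> (SE ^^ 2) ` module_End sA act" if \<psi>: "\<psi> \<in> module_End sA act" for \<psi>
  proof -
    let ?\<phi> = "\<lambda>a. ?\<mu> (\<psi> (\<nu> a))"
    have inj: "a = b" if "\<nu> a = \<nu> b" for a b using that \<mu>(2) by metis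
    have "?\<phi> \<in> module_End sA act"
    proof -
      have \<nu>_lin: "\<nu> (a + b) = \<nu> a + \<nu> b" "\<nu> (sA c a) = sA c (\<nu> a)" for a b c
        using linear_nu by (simp_all add: Vector_Spaces.linear_iff)
      have \<psi>_lin: "\<psi> (a + b) = \<psi> a + \<psi> b" "\<psi> (sA c a) = sA c (\<psi> a)" "\<psi> (act h a) = act h (\<psi> a)"
        for a b c h
        using \<psi> by (simp_all add: module_End_def Vector_Spaces.linear_iff)
      have "?\<phi> (a + b) = ?\<phi> a + ?\<phi> b" for a b by (rule inj) (simp add: \<mu>(1) \<nu>_lin \<psi>_lin)
      moreover have "?\<phi> (sA c a) = sA c (?\<phi> a)" for a c by (rule inj) (simp add: \<mu>(1) \<nu>_lin \<psi>_lin)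
      moreover have "?\<phi> (act h a) = act h (?\<phi> a)" for a h
        by (rule inj) (simp add: \<mu>(1) nu_act \<psi>_lin)
      ultimately show ?thesis
        unfolding module_End_def Vector_Spaces.linear_iff using alg.vector_space_axioms by blast
    qed
    moreover have "(SE ^^ 2) ?\<phi> = \<psi>"
      using SS(2)[OF calculation] by (simp add: \<mu> fun_eq_iff)
    ultimately show ?thesis by (metis imageI)
  qed
  then show "(SE ^^ 2) ` module_End sA act = module_End sA act" using SS(1) by blast
qed

end


section \<open>The order of the antipode\<close>

context cocommutative_action
begin

lemma monoid_dual_algebra: "monoid (dual_algebra sH \<Delta> \<epsilon>)"
  and mult_dual_algebra: "functional f \<Longrightarrow> functional g \<Longrightarrow> f \<otimes>\<^bsub>dual_algebra sH \<Delta> \<epsilon>\<^esub> g = conv f g"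
  and one_dual_algebra: "\<one>\<^bsub>dual_algebra sH \<Delta> \<epsilon>\<^esub> = \<epsilon>"
  and carrier_dual_algebra: "carrier (dual_algebra sH \<Delta> \<epsilon>) = Collect functional"
proof -
  let ?G = "dual_algebra sH \<Delta> \<epsilon>"
  show c: "carrier ?G = Collect functional" and o: "\<one>\<^bsub>?G\<^esub> = \<epsilon>"
    by (simp_all add: dual_algebra_def)
  have m: "f \<otimes>\<^bsub>?G\<^esub> g = conv f g" if "functional f" "functional g" for f g
  proof
    fix h
    have "bilin (*) (\<lambda>x y. f x * g y)"
      using that by (simp add: bilinear_on_def linear_on_def functional_iff algebra_simps)
    from sw_sum[OF vector_space_times this] show "(f \<otimes>\<^bsub>?G\<^esub> g) h = conv f g h"
      by (simp add: dual_algebra_def conv_def)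
  qed
  then show "functional f \<Longrightarrow> functional g \<Longrightarrow> f \<otimes>\<^bsub>?G\<^esub> g = conv f g" .
  have "conv \<epsilon> f = f" if "functional f" for f
    using conv_commute[OF functional_counit that] conv_counit[OF that] by simp
  then show "monoid ?G"
    by unfold_locales (simp_all add: c o m functional_conv conv_assoc conv_counit functional_counit)
qed

text \<open>Algebra homomorphisms \<open>H \<rightarrow> k\<close> have the convolution inverse \<open>a \<circ> S\<close>.\<close>

lemma character_unit:
  assumes a: "functional a" "\<And>g h. a (g * h) = a g * a h" "a 1 = 1"
  shows "a \<in> Units (dual_algebra sH \<Delta> \<epsilon>)"
proof -
  interpret a: Vector_Spaces.linear sH "(*)" a by (rule a(1))
  have aS: "functional (a \<circ> S)"
    using a(1) by (simp add: functional_iff antipode_add antipode_scale)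
  have "conv a (a \<circ> S) h = \<epsilon> h" for h
  proof -
    have "conv a (a \<circ> S) h = a (\<Sum>b\<in>B. D b h * S b)"
      by (simp add: conv_def a.sum a(2))
    then show ?thesis by (simp add: antipode_right_sum a.scale a(3))
  qed
  then have "conv a (a \<circ> S) = \<epsilon>" by blast
  moreover from this have "conv (a \<circ> S) a = \<epsilon>" using conv_commute[OF a(1) aS] by simp
  ultimately show ?thesis
    unfolding Units_def carrier_dual_algebra one_dual_algebra using a(1) aS
    by (intro CollectI conjI bexI[of _ "a \<circ> S"]) (simp_all add: mult_dual_algebra)
qed

end

lemma (in galois_integral) pow_units_dual_algebra:
  "\<alpha> [^]\<^bsub>units_of (dual_algebra sH \<Delta> \<epsilon>)\<^esub> m = \<alpha>pow m"
proof -
  have "functional (\<alpha>pow m) \<and> \<alpha> [^]\<^bsub>units_of (dual_algebra sH \<Delta> \<epsilon>)\<^esub> m = \<alpha>pow m"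
    by (induction m)
      (simp_all add: units_of_one units_of_mult one_dual_algebra functional_counit functional_conv
        mult_dual_algebra functional_\<alpha>)
  then show ?thesis ..
qed

lemma pow_BijGroup:
  assumes f: "bij_betw f X X"
  shows "restrict f X \<in> carrier (BijGroup X)"
    and "restrict f X [^]\<^bsub>BijGroup X\<^esub> (m::nat) = \<one>\<^bsub>BijGroup X\<^esub> \<longleftrightarrow> (\<forall>x\<in>X. (f ^^ m) x = x)"
proof -
  have B: "restrict g X \<in> Bij X" if "bij_betw g X X" for g
    using that by (simp add: Bij_def bij_betw_restrict_eq)
  have mult: "g \<otimes>\<^bsub>BijGroup X\<^esub> h = compose X g h" if "g \<in> Bij X" "h \<in> Bij X" for g h
    using that by (simp add: BijGroup_def)
  show "restrict f X \<in> carrier (BijGroup X)" using B[OF f] by (simp add: BijGroup_def)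
  have "bij_betw (f ^^ m) X X \<and> restrict f X [^]\<^bsub>BijGroup X\<^esub> m = restrict (f ^^ m) X"
  proof (induction m)
    case 0
    show ?case using bij_betw_id[of X] by (simp add: BijGroup_def id_def)
  next
    case (Suc m)
    have fX: "f x \<in> X" if "x \<in> X" for x using f that by (auto dest: bij_betwE)
    have "bij_betw (f ^^ m \<circ> f) X X" by (rule bij_betw_trans[OF f conjunct1[OF Suc]])
    moreover have "restrict f X [^]\<^bsub>BijGroup X\<^esub> Suc m = compose X (restrict (f ^^ m) X) (restrict f X)"
      unfolding nat_pow_Suc conjunct2[OF Suc] by (rule mult[OF B[OF conjunct1[OF Suc]] B[OF f]])
    moreover have "compose X (restrict (f ^^ m) X) (restrict f X) = restrict (f ^^ m \<circ> f) X"
      by (simp add: compose_def fX fun_eq_iff)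
    ultimately show ?case unfolding funpow_Suc_right by (intro conjI) (simp_all only:)
  qed
  then have "restrict f X [^]\<^bsub>BijGroup X\<^esub> m = \<one>\<^bsub>BijGroup X\<^esub>
      \<longleftrightarrow> restrict (f ^^ m) X = (\<lambda>x\<in>X. x)" by (simp add: BijGroup_def)
  also have "\<dots> \<longleftrightarrow> (\<forall>x\<in>X. (f ^^ m) x = x)"
    by (auto simp: fun_eq_iff)
  finally show "restrict f X [^]\<^bsub>BijGroup X\<^esub> m = \<one>\<^bsub>BijGroup X\<^esub> \<longleftrightarrow> (\<forall>x\<in>X. (f ^^ m) x = x)" .
qed

lemma central_simple_algebra_of_basis:
  assumes "unital_algebra s UNIV (*) (1 :: 'a::ring_1)" "central_simple s"
    and "finite_basis s C" "1 \<in> C"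
  shows "central_simple_algebra s C"
proof -
  interpret unital_algebra s UNIV "(*)" "1 :: 'a" by (rule assms(1))
  interpret finite_basis s C by (rule assms(3))
  show ?thesis
  proof
    show "s c a * b = s c (a * b)" "a * s c b = s c (a * b)" for c a b
      using mul_bilinear by (simp_all add: bilinear_on_def linear_on_def)
    show "z \<in> range (\<lambda>c. s c 1)" if "\<And>a. z * a = a * z" for z
      using assms(2) that unfolding central_simple_def by blast
    show "I = {0} \<or> I = UNIV" if "two_sided_ideal I" for I :: "'a set"
      using assms(2) that unfolding central_simple_def by blast
  qed (rule assms(4))
qed

theorem theorem3p8:
  fixes sH :: "'k::field \<Rightarrow> 'h::ring_1 \<Rightarrow> 'h"
    and \<Delta>H :: "'h \<Rightarrow> (('h \<Rightarrow> 'h \<Rightarrow> 'k) \<Rightarrow> 'k)" and \<epsilon>H :: "'h \<Rightarrow> 'k" and SH :: "'h \<Rightarrow> 'h"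
    and sA :: "'k \<Rightarrow> 'a::ring_1 \<Rightarrow> 'a" and act :: "'h \<Rightarrow> 'a \<Rightarrow> 'a"
    and E :: "('a \<Rightarrow> 'a) set"
    and \<Delta>E :: "('a \<Rightarrow> 'a) \<Rightarrow> ((('a \<Rightarrow> 'a) \<Rightarrow> ('a \<Rightarrow> 'a) \<Rightarrow> 'k) \<Rightarrow> 'k)"
    and \<epsilon>E :: "('a \<Rightarrow> 'a) \<Rightarrow> 'k" and S :: "('a \<Rightarrow> 'a) \<Rightarrow> ('a \<Rightarrow> 'a)"
    and \<alpha> :: "'h \<Rightarrow> 'k" and n :: nat
  assumes H: "hopf_algebra sH UNIV (*) 1 \<Delta>H \<epsilon>H SH"
    and finite_dim_H: "finite_dim sH"
    and A: "module_algebra sH UNIV (*) 1 \<Delta>H \<epsilon>H SH sA act"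
    and galois: "dual_galois sH sA act"
    and E_def: "E = module_End sA act"
    and E: "module_algebra (fun_scale sA) E (\<circ>) id \<Delta>E \<epsilon>E S sA (\<lambda>\<phi> a. \<phi> a)"
    and cocomm: "cocommutative sH \<Delta>H"
    and csa: "central_simple sA"
    and modular: "modular_function sH \<epsilon>H \<alpha>"
    and n_def: "n = group.ord (units_of (dual_algebra sH \<Delta>H \<epsilon>H)) \<alpha>"
  shows "(\<forall>\<phi>\<in>E. (S ^^ (2 * n)) \<phi> = \<phi>) \<and>
    ((\<forall>g. grouplike sH \<Delta>H \<epsilon>H g \<and> (\<forall>h. g * h = h * g) \<longrightarrow> g = 1)
      \<longrightarrow> group.ord (BijGroup E) (restrict (S ^^ 2) E) = n)"
proof -
  interpret A: module_algebra sH UNIV "(*)" 1 \<Delta>H \<epsilon>H SH sA act by (rule A)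
  obtain B where B: "finite_basis sH B"
    by (rule finite_basis_exists[OF A.vector_space_axioms finite_dim_H])
  have "finite_dim sA" using csa by (simp add: central_simple_def)
  then obtain C where C: "finite_basis sA C" "1 \<in> C"
    using finite_basis_exists_containing[OF A.alg.vector_space_axioms _ zero_neq_one[symmetric]] by metis
  have csaC: "central_simple_algebra sA C"
    by (rule central_simple_algebra_of_basis[OF A.alg.unital_algebra_axioms csa C])
  obtain x where x: "left_integral sH \<epsilon>H x" "\<And>h. x * h = sH (\<alpha> h) x"
    using modular unfolding modular_function_def by blast
  have \<alpha>: "Vector_Spaces.linear sH (*) \<alpha>" "\<And>g h. \<alpha> (g * h) = \<alpha> g * \<alpha> h" "\<alpha> 1 = 1"
    using modular unfolding modular_function_def by blast+
  interpret galois_integral sH \<Delta>H \<epsilon>H SH sA act B C x \<alpha>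
    by (intro galois_integral.intro galois_action.intro cocommutative_action.intro
        galois_action_axioms.intro galois_integral_axioms.intro cocommutative_action_axioms.intro
        A B csaC galois cocomm x(2) \<alpha>(1))
      (use x(1) in \<open>simp_all add: left_integral_def\<close>)
  let ?U = "units_of (dual_algebra sH \<Delta>H \<epsilon>H)"
  interpret U: group ?U
    by (rule monoid.units_group[OF monoid_dual_algebra])
  have \<alpha>_U: "\<alpha> \<in> carrier ?U"
    unfolding units_of_carrier by (rule character_unit[OF \<alpha>])
  have n: "\<alpha>pow m = \<epsilon>H \<longleftrightarrow> n dvd m" for m
    using U.pow_eq_id[OF \<alpha>_U, of m]
    by (simp add: n_def pow_units_dual_algebra units_of_one one_dual_algebra)
  note E' = E[unfolded E_def]
  have "(S ^^ (2 * n)) \<phi> = \<phi>" if "\<phi> \<in> E" for \<phi>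
    using antipode_square_pow_eq_id[OF E', of n \<phi>] n[of n] that
    by (simp add: E_def funpow_mult mult.commute)
  moreover have "group.ord (BijGroup E) (restrict (S ^^ 2) E) = n"
    if central: "\<forall>g. grouplike sH \<Delta>H \<epsilon>H g \<and> (\<forall>h. g * h = h * g) \<longrightarrow> g = 1"
  proof -
    have bij: "bij_betw (S ^^ 2) E E" unfolding E_def by (rule antipode_square_bij[OF E'])
    have "(\<forall>\<phi>\<in>E. ((S ^^ 2) ^^ m) \<phi> = \<phi>) \<longleftrightarrow> n dvd m" for m
      unfolding n[symmetric] E_def
      using antipode_square_pow_eq_id[OF E'] antipode_square_pow_eq_id_converse[OF E'] central
      by blast
    then show ?thesis
      by (simp add: group.ord_unique[OF group_BijGroup pow_BijGroup(1)[OF bij]] pow_BijGroup(2)[OF bij])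
  qed
  ultimately show ?thesis by blast
qed

end
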